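(* Let $n\ge 1$, let $a,b,c\in\{1,\dots,n+3\}$ be pairwise distinct, let ${}^{abc}\mathcal G^4_{n+3}$ be the groupoid of flips of Delaunay triangulations, and let $\zeta_1,\dots,\zeta_{n+3}\in\mathbb Q$ be pairwise distinct. To each generator $g^{H}_{H'}$ assign the matrix $A^{H}_{H'}\in\mathrm{GL}_{2n+1}(\mathbb Q)$, with respect to the ordered bases of triangles of $H$ and $H'$, of the linear map $\gamma:\mathbb Q^{(\mathbf T)}\to\mathbb Q^{(\mathbf T')}$ given as follows: if $H'=H$ it is the identity; if $H'$ is obtained from $H$ by the flip $ik\to jl$ in the quadrilateral $(i,j,k,l)$, then $$\gamma(\Delta)=\Delta\quad\text{for }\Delta\in\mathbf T\cap\mathbf T',$$ $$\gamma(\Delta_{ijk})=\frac{\zeta_i-\zeta_l}{\zeta_i-\zeta_k}\Delta_{ijl}+\frac{\zeta_l-\zeta_k}{\zeta_i-\zeta_k}\Delta_{jkl},\qquad \gamma(\Delta_{ikl})=\frac{\zeta_i-\zeta_j}{\zeta_i-\zeta_k}\Delta_{ijl}+\frac{\zeta_j-\zeta_k}{\zeta_i-\zeta_k}\Delta_{jkl}.$$ Define $f_{n+3}:{}^{abc}\mathcal G^4_{n+3}\to \mathrm{GL}_{2n+1}(\mathbb Q)$ on composable words by $$f_{n+3}\big(g^{H_p}_{H_q}g^{H_q}_{H_r}\cdots g^{H_t}_{H_u}g^{H_u}_{H_v}\big)=A^{H_u}_{H_v}A^{H_t}_{H_u}\cdots A^{H_q}_{H_r}A^{H_p}_{H_q}.$$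 Then $f_{n+3}$ is a homomorphism; that is, it is well defined on the groupoid (it respects all defining relations), it sends identities to the identity matrix, and it sends products to products of matrices (taken in the order of composition of linear maps, as in the displayed formula).
   Context: **Delaunay triangulations.** Consider $n+3$ points in the plane labeled $1,\dots,n+3$, where the points $a,b,c$ have fixed positions and the other $n$ points lie in the interior of the triangle $abc$, in general position (no four points lie on a circle having no other of the points in its interior). The Delaunay triangulation is the plane graph in which three points are joined pairwise by edges whenever the interior of the circle through them contains no other of the points. It is recorded as its set $H$ of edges (unordered pairs of labels). It is strict if every face, including the outer one, is a triangle; here it is always strict with outer face $abc$ and $|H|=3n+3$. A flip $ik\to jl$ replaces the diagonal $ik$ of a quadrilateral with cyclically ordered vertices $(i,j,k,l)$, formed by the two triangles $ijk$ and $ikl$, by the other diagonal $jl$, so the triangles $ijk,ikl$ are replaced by $ijl,jkl$. **The groupoid ${}^{abc}\mathcal G^4_{n+3}$.** Its objects are all strict Delaunay triangulations $H$ (sets of edges) with outer face $abc$ on $n+3$ points labeled $1,\dots,n+3$, with $a,b,c$ at their fixed positions. It is generated by morphisms $g^{H}_{H'}$ from $H$ to $H'$, one for each pair with $H'=H$ or with $H'$ obtained from $H$ by one flip (in which case $|H\cap H'|=3n+2$). The product $g^{H}_{H'}g^{H'}_{H''}$ (first $g^{H}_{H'}$) is defined when the lower index of the first factor equals the upper index of the second. The defining relations are: (I) $g^{H}_{H}=1$; (II) $g^{H}_{H'}g^{H'}_{H}=1$; (III) $g^{H_1}_{H_2}g^{H_2}_{H_3}g^{H_3}_{H_4}g^{H_4}_{H_5}g^{H_5}_{H_1}=1$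 whenever $H_1,\dots,H_5$ are the five triangulations obtained by cyclically changing the triangulation of one pentagon containing no other points in its interior, the rest being unchanged; (IV) $g^{H}_{H'}g^{H'}_{H''}=g^{H}_{H'''}g^{H'''}_{H''}$ whenever the two sides perform, in the two possible orders, two flips in two different quadrilaterals that contain no other points in their interiors and have at most two points in common (so they share no triangle). **Triangle spaces.** For a triangulation $H$, $\mathbf T$ denotes its set of triangular faces excluding the outer face $abc$; $|\mathbf T|=2n+1$. The face with vertices $p,q,r$ is denoted $\Delta_{pqr}$ (unordered indices, written in increasing order when ordering the basis). $\mathbb Q^{(\mathbf T)}$ is the $\mathbb Q$-vector space with basis $\mathbf T$, ordered lexicographically by the increasing index triples. $\mathbf T'$ is the corresponding set for $H'$. The matrix of $\gamma$ has as columns the coordinates of the images of basis vectors. For a flip in the quadrilateral, the index $i$ is taken to be the smallest label (if the flip removes the diagonal containing it), $k$ the other endpoint of that diagonal, and $j<l$ the remaining labels; for the opposite flip $jl\to ik$ one uses the same formulas with the roles of the pairs $(i,k)$ and $(j,l)$ interchanged. (The formulas are unchanged under $i\leftrightarrow k$ and under $j\leftrightarrow l$.) *)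

theory Defs
  imports
    "HOL-Analysis.Analysis"
    "HOL-Library.List_Lexorder"
    "Jordan_Normal_Form.Matrix"
begin

type_synonym edges = "nat set set"

text \<open>
  The plane is \<^typ>\<open>complex\<close>. The points have the labels \<open>1, \<dots>, n + 3\<close>; the labels \<open>a\<close>, \<open>b\<close>, \<open>c\<close>
  sit at the fixed positions \<open>pa\<close>, \<open>pb\<close>, \<open>pc\<close>. Only the values of \<open>P\<close> on labels matter.
\<close>

definition drawing :: "(nat \<Rightarrow> complex) \<Rightarrow> edges \<Rightarrow> complex set" where
  "drawing P H = (\<Union>e\<in>H. convex hull (P ` e))"

text \<open>The connected components of the complement of the drawing are the faces of the plane graph.
  The unbounded one is never the interior of a triangle, so the outer face is not counted here.\<close>

definition triangular_faces :: "(nat \<Rightarrow> complex) \<Rightarrow> edges \<Rightarrow> nat set set" where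
  "triangular_faces P H =
     {{p, q, r} | p q r. distinct [p, q, r] \<and> {{p, q}, {q, r}, {p, r}} \<subseteq> H \<and>
        interior (convex hull {P p, P q, P r}) \<in> components (- drawing P H)}"

context
  fixes n a b c :: nat and pa pb pc :: complex
begin

definition general_position :: "(nat \<Rightarrow> complex) \<Rightarrow> bool" where
  "general_position P \<longleftrightarrow>
     \<not> (\<exists>S z \<rho>. S \<subseteq> {1..n+3} \<and> card S = 4 \<and> P ` S \<subseteq> sphere z \<rho> \<and>
          P ` {1..n+3} \<inter> ball z \<rho> = {})"

definition configuration :: "(nat \<Rightarrow> complex) \<Rightarrow> bool" where
  "configuration P \<longleftrightarrow>
     inj_on P {1..n+3} \<and> P a = pa \<and> P b = pb \<and> P c = pc \<and>
     P ` ({1..n+3} - {a, b, c}) \<subseteq> interior (convex hull {pa, pb, pc}) \<and>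
     general_position P"

definition delaunay_triple :: "(nat \<Rightarrow> complex) \<Rightarrow> nat \<Rightarrow> nat \<Rightarrow> nat \<Rightarrow> bool" where
  "delaunay_triple P p q r \<longleftrightarrow>
     {p, q, r} \<subseteq> {1..n+3} \<and> distinct [p, q, r] \<and>
     (\<exists>z \<rho>. {P p, P q, P r} \<subseteq> sphere z \<rho> \<and> P ` {1..n+3} \<inter> ball z \<rho> = {})"

definition delaunay_edges :: "(nat \<Rightarrow> complex) \<Rightarrow> edges" where
  "delaunay_edges P = {{p, q} | p q r. delaunay_triple P p q r}"

definition strict_with_outer_face :: "(nat \<Rightarrow> complex) \<Rightarrow> edges \<Rightarrow> bool" where
  "strict_with_outer_face P H \<longleftrightarrow>
     {{a, b}, {b, c}, {a, c}} \<subseteq> H \<and>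
     components (- drawing P H) =
       insert (- (convex hull {pa, pb, pc}))
         ((\<lambda>t. interior (convex hull (P ` t))) ` triangular_faces P H)"

definition realizes :: "(nat \<Rightarrow> complex) \<Rightarrow> edges \<Rightarrow> bool" where
  "realizes P H \<longleftrightarrow> configuration P \<and> H = delaunay_edges P \<and> strict_with_outer_face P H"

definition triangulations :: "edges set" where
  "triangulations = {H. \<exists>P. realizes P H}"

text \<open>The set \<open>\<^bold>T\<close> of \<open>H\<close>. The graph \<open>H\<close> is a triangulation of the sphere with at least four vertices,
  hence 3-connected, and by Whitney's theorem its faces do not depend on the realization chosen.\<close>

definition triangles :: "edges \<Rightarrow> nat set set" where
  "triangles H = triangular_faces (SOME P. realizes P H) H"

text \<open>\<open>flip i j k l H H'\<close> is the flip \<open>ik \<rightarrow> jl\<close> in the quadrilateral with cyclically ordered vertices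
  \<open>(i, j, k, l)\<close>.\<close>

definition flip :: "nat \<Rightarrow> nat \<Rightarrow> nat \<Rightarrow> nat \<Rightarrow> edges \<Rightarrow> edges \<Rightarrow> bool" where
  "flip i j k l H H' \<longleftrightarrow>
     H \<in> triangulations \<and> H' \<in> triangulations \<and> distinct [i, j, k, l] \<and>
     {i, j, k} \<in> triangles H \<and> {i, k, l} \<in> triangles H \<and> {j, l} \<notin> H \<and>
     H' = H - {{i, k}} \<union> {{j, l}} \<and>
     triangles H' = triangles H - {{i, j, k}, {i, k, l}} \<union> {{i, j, l}, {j, k, l}}"

definition generator :: "edges \<Rightarrow> edges \<Rightarrow> bool" where
  "generator H H' \<longleftrightarrow>
     H \<in> triangulations \<and> H' \<in> triangulations \<and> (H' = H \<or> (\<exists>i j k l. flip i j k l H H'))"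

text \<open>The fans of the pentagon \<open>(p, q, r, s, t)\<close> at \<open>p\<close>, \<open>s\<close>, \<open>q\<close>, \<open>t\<close>, \<open>r\<close>, in this order. Relabelling
  the pentagon gives all starting points and both directions.\<close>

definition pentagon_cycle :: "edges \<Rightarrow> edges \<Rightarrow> edges \<Rightarrow> edges \<Rightarrow> edges \<Rightarrow> bool" where
  "pentagon_cycle H1 H2 H3 H4 H5 \<longleftrightarrow>
     (\<exists>p q r s t. distinct [p, q, r, s, t] \<and>
        {{p, q, r}, {p, r, s}, {p, s, t}} \<subseteq> triangles H1 \<and>
        flip p q r s H1 H2 \<and> flip p q s t H2 H3 \<and> flip q r s t H3 H4 \<and>
        flip q r t p H4 H5 \<and> flip r s t p H5 H1)"

definition commuting_flips :: "edges \<Rightarrow> edges \<Rightarrow> edges \<Rightarrow> edges \<Rightarrow> bool" where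
  "commuting_flips H H' H'' H''' \<longleftrightarrow>
     (\<exists>i j k l i' j' k' l'. card ({i, j, k, l} \<inter> {i', j', k', l'}) \<le> 2 \<and>
        flip i j k l H H' \<and> flip i' j' k' l' H' H'' \<and>
        flip i' j' k' l' H H''' \<and> flip i j k l H''' H'')"

text \<open>The list \<open>[H\<^sub>0, H\<^sub>1, \<dots>, H\<^sub>m]\<close> encodes the composable word with the \<open>m\<close> letters
  \<open>g\<close> from \<open>H\<^sub>0\<close> to \<open>H\<^sub>1\<close>, \dots, \<open>g\<close> from \<open>H\<^sub>m\<^sub>-\<^sub>1\<close> to \<open>H\<^sub>m\<close>; \<open>[H]\<close> is the empty word at \<open>H\<close>.\<close>

definition is_word :: "edges list \<Rightarrow> bool" where
  "is_word w \<longleftrightarrow> w \<noteq> [] \<and> set w \<subseteq> triangulations \<and> successively generator w"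

definition concat_words :: "edges list \<Rightarrow> edges list \<Rightarrow> edges list" where
  "concat_words u v = u @ tl v"

inductive word_equiv :: "edges list \<Rightarrow> edges list \<Rightarrow> bool" where
  rel_I: "H \<in> triangulations \<Longrightarrow> word_equiv [H, H] [H]"
| rel_II: "generator H H' \<Longrightarrow> generator H' H \<Longrightarrow> word_equiv [H, H', H] [H]"
| rel_III: "pentagon_cycle H1 H2 H3 H4 H5 \<Longrightarrow> word_equiv [H1, H2, H3, H4, H5, H1] [H1]"
| rel_IV: "commuting_flips H H' H'' H''' \<Longrightarrow> word_equiv [H, H', H''] [H, H''', H'']"
| refl: "is_word u \<Longrightarrow> word_equiv u u"
| sym: "word_equiv u v \<Longrightarrow> word_equiv v u"
| trans: "word_equiv u v \<Longrightarrow> word_equiv v w \<Longrightarrow> word_equiv u w"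
| cong: "word_equiv u v \<Longrightarrow> is_word x \<Longrightarrow> is_word y \<Longrightarrow> last x = hd u \<Longrightarrow> last u = hd y \<Longrightarrow>
    word_equiv (concat_words x (concat_words u y)) (concat_words x (concat_words v y))"

text \<open>The groupoid: its morphisms are the classes of words. By relation II every class is invertible,
  so the quotient of the free category on the generators is the groupoid they present.\<close>

definition word_class :: "edges list \<Rightarrow> edges list set" where
  "word_class u = {v. word_equiv u v}"

definition Hom :: "edges \<Rightarrow> edges \<Rightarrow> edges list set set" where
  "Hom H H' = {word_class w | w. is_word w \<and> hd w = H \<and> last w = H'}"

definition identity_mor :: "edges \<Rightarrow> edges list set" where
  "identity_mor H = word_class [H]"

definition compose_mor :: "edges list set \<Rightarrow> edges list set \<Rightarrow> edges list set" where
  "compose_mor m m' = (\<Union>u\<in>m. \<Union>v\<in>m'. word_class (concat_words u v))"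

text \<open>Elements of \<open>\<rat>\<close>-vector spaces with a basis of triangles are coordinate functions.\<close>

definition basis_vector :: "nat set \<Rightarrow> nat set \<Rightarrow> rat" where
  "basis_vector t = (\<lambda>t'. if t' = t then 1 else 0)"

text \<open>The diagonals \<open>ik\<close> and \<open>jl\<close> are recovered from \<open>H\<close> and \<open>H'\<close>, with \<open>i < k\<close> and \<open>j < l\<close>.\<close>

definition gamma_basis :: "(nat \<Rightarrow> rat) \<Rightarrow> edges \<Rightarrow> edges \<Rightarrow> nat set \<Rightarrow> nat set \<Rightarrow> rat" where
  "gamma_basis \<zeta> H H' t =
     (if H' = H then basis_vector t
      else
        let i = Min (the_elem (H - H')); k = Max (the_elem (H - H'));
            j = Min (the_elem (H' - H)); l = Max (the_elem (H' - H))
        in if t = {i, j, k} then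
             (\<lambda>t'. (\<zeta> i - \<zeta> l) / (\<zeta> i - \<zeta> k) * basis_vector {i, j, l} t'
                 + (\<zeta> l - \<zeta> k) / (\<zeta> i - \<zeta> k) * basis_vector {j, k, l} t')
           else if t = {i, k, l} then
             (\<lambda>t'. (\<zeta> i - \<zeta> j) / (\<zeta> i - \<zeta> k) * basis_vector {i, j, l} t'
                 + (\<zeta> j - \<zeta> k) / (\<zeta> i - \<zeta> k) * basis_vector {j, k, l} t')
           else basis_vector t)"

definition gamma :: "(nat \<Rightarrow> rat) \<Rightarrow> edges \<Rightarrow> edges \<Rightarrow> (nat set \<Rightarrow> rat) \<Rightarrow> nat set \<Rightarrow> rat" where
  "gamma \<zeta> H H' x = (\<lambda>t'. \<Sum>t\<in>triangles H. x t * gamma_basis \<zeta> H H' t t')"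

text \<open>\<^theory>\<open>HOL-Library.List_Lexorder\<close> orders the increasing index triples lexicographically.\<close>

definition ordered_basis :: "edges \<Rightarrow> nat set list" where
  "ordered_basis H = map set (sorted_list_of_set (sorted_list_of_set ` triangles H))"

definition flip_matrix :: "(nat \<Rightarrow> rat) \<Rightarrow> edges \<Rightarrow> edges \<Rightarrow> rat mat" where
  "flip_matrix \<zeta> H H' =
     Matrix.mat (length (ordered_basis H')) (length (ordered_basis H))
       (\<lambda>(r, s). gamma \<zeta> H H' (basis_vector (ordered_basis H ! s)) (ordered_basis H' ! r))"

fun word_matrix :: "(nat \<Rightarrow> rat) \<Rightarrow> edges list \<Rightarrow> rat mat" where
  "word_matrix \<zeta> (H # H' # w) = word_matrix \<zeta> (H' # w) * flip_matrix \<zeta> H H'"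
| "word_matrix \<zeta> w = 1\<^sub>m (2 * n + 1)"

text \<open>The common value of \<open>word_matrix\<close> on all words representing the morphism.\<close>

definition flip_rep :: "(nat \<Rightarrow> rat) \<Rightarrow> edges list set \<Rightarrow> rat mat" where
  "flip_rep \<zeta> m = the_elem (word_matrix \<zeta> ` m)"

end

definition GL :: "nat \<Rightarrow> rat mat set" where
  "GL d = {X \<in> carrier_mat d d. invertible_mat X}"

end

theory Submission
  imports Defs
begin

text \<open>
  The matrices have size \<open>2 * n + 1\<close> because of a ray count. Fix a generic direction. Every triangle
  has exactly one vertex (the one of middle height) and exactly one orientation of the direction such
  that the ray from the vertex enters the triangle. At an interior point both rays enter a face,
  and among the six rays at \<open>a\<close>, \<open>b\<close>, \<open>c\<close> exactly one enters \<open>abc\<close>; so the faces correspond to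
  \<open>2 * n + 1\<close> rays. This uses that every point is a vertex of the Delaunay graph and that no point lies
  inside an edge or a face.

  The flip map is the recursion \<open>(\<zeta>\<^sub>i - \<zeta>\<^sub>k) f[i,j,k] = (\<zeta>\<^sub>i - \<zeta>\<^sub>l) f[i,j,l] + (\<zeta>\<^sub>l - \<zeta>\<^sub>k) f[j,k,l]\<close> of second
  divided differences. Hence it preserves the sums of \<open>x\<^sub>t f[t]\<close> over all triangles \<open>t\<close>, for every
  function \<open>f\<close> on the labels. The divided differences of a quadrilateral or of a fan of a pentagon are
  linearly independent, so a cycle of flips inside it is the identity: relations II and III.
  Flips in quadrilaterals without a common triangle act on disjoint sets of coordinates: relation IV.
\<close>

section \<open>Delaunay edges\<close>

text \<open>Strict convexity: the open chord between two points of a sphere lies in the open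
  ball.\<close>

lemma sphere_segment_endpoint:
  fixes x y :: "'a::euclidean_space"
  assumes "x \<in> sphere z \<rho>" "y \<in> sphere z \<rho>" "u \<in> closed_segment x y" "u \<notin> ball z \<rho>"
  shows "u = x \<or> u = y"
proof (rule ccontr)
  assume "\<not> (u = x \<or> u = y)"
  then have "u \<in> open_segment x y"
    using assms by (auto simp: open_segment_def)
  from dist_decreases_open_segment[OF this, of z] show False
    using assms by auto
qed

text \<open>An edge is a chord of an empty circle, and the relative interior of a chord is inside
  the circle.\<close>

lemma delaunay_edge_endpoint:
  assumes "inj_on P {1..n+3}" "{p, q} \<in> delaunay_edges n P" "v \<in> {1..n+3}"
    and "P v \<in> closed_segment (P p) (P q)"
  shows "v = p \<or> v = q"
proof -
  from assms(2) obtain p' q' r where pqr: "{p, q} = {p', q'}" "delaunay_triple n P p' q' r"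
    unfolding delaunay_edges_def by blast
  then obtain z \<rho> where d: "{p, q} = {p', q'}" "{p', q', r} \<subseteq> {1..n+3}"
    "{P p', P q', P r} \<subseteq> sphere z \<rho>" "P ` {1..n+3} \<inter> ball z \<rho> = {}"
    unfolding delaunay_triple_def by (elim conjE exE)
  have pq: "p \<in> {p', q'}" "q \<in> {p', q'}" using d(1) by auto
  have "P p \<in> sphere z \<rho>" "P q \<in> sphere z \<rho>" "P v \<notin> ball z \<rho>" "p \<in> {1..n+3}" "q \<in> {1..n+3}"
    using pq d(2-4) assms(3) by blast+
  from sphere_segment_endpoint[OF this(1,2) assms(4) this(3)] this(4,5)
  show ?thesis
    using inj_onD[OF assms(1) _ assms(3)] by blast
qed

section \<open>Delaunay edges at every labelled point\<close>

lemma exists_normal_off_line: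
  fixes e y :: complex
  assumes "\<not> collinear {0, e, y}"
  shows "\<exists>N. inner e N = 0 \<and> inner y N > 0"
proof -
  have ne: "e \<noteq> 0" and nr: "y / e \<notin> \<real>"
    using assms by (auto simp: collinear_iff_Reals)
  \<comment> \<open>The normal will be \<open>\<i> * e\<close> or its negative. The product with
    \<open>y\<close> is the imaginary part of \<open>y * cnj e\<close>, which vanishes only if
    \<open>y / e\<close> is real.\<close>
  have "inner y (\<i> * e) \<noteq> 0"
  proof
    assume "inner y (\<i> * e) = 0"
    then have "Im (y * cnj e) = 0"
      by (simp add: inner_complex_def algebra_simps)
    then have "Im (y / e) = 0"
      by (simp add: complex_div_cnj[of y e])
    then show False using nr by (simp add: complex_is_Real_iff)
  qed
  moreover have "inner e (\<i> * e) = 0" "inner e (- (\<i> * e)) = 0"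
    by (simp_all add: inner_complex_def)
  ultimately show ?thesis
    by (metis inner_minus_right less_minus_iff linorder_less_linear minus_zero)
qed

text \<open>Join \<open>x\<close> to a nearest neighbour \<open>y\<close>; the circle with diameter \<open>xy\<close> is empty. Moving the centre
  along the bisector, on the side of some further point, the circle stays empty until it first
  meets a point of the set on that side.\<close>

lemma exists_empty_circle_through:
  fixes X :: "complex set"
  assumes "finite X" "x \<in> X" "\<not> collinear X"
  shows "\<exists>y z c \<rho>. y \<in> X \<and> z \<in> X \<and> distinct [x, y, z] \<and> {x, y, z} \<subseteq> sphere c \<rho> \<and> X \<inter> ball c \<rho> = {}"
proof -
  have "X - {x} \<noteq> {}"
    using assms(2,3) collinear_sing[of x] by (metis Diff_eq_empty_iff subset_singleton_iff empty_iff)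
  then obtain y where y: "y \<in> X" "y \<noteq> x" and near: "\<And>u. u \<in> X \<Longrightarrow> u \<noteq> x \<Longrightarrow> dist x y \<le> dist x u"
    using assms(1) arg_min_if_finite[of "X - {x}" "dist x"]
    by (metis (no_types, lifting) Diff_iff finite_Diff insertI1 linorder_not_le insertE emptyE)
  define e where "e = y - x"
  \<comment> \<open>The power of \<open>u\<close> with respect to the circle with diameter
    \<open>xy\<close>.\<close>
  define h where "h u = inner (u - x) (u - y)" for u
  \<comment> \<open>Nearness of \<open>y\<close> gives \<open>norm e \<le> norm (u - x)\<close>, so
    Cauchy-Schwarz bounds \<open>inner (u - x) e\<close> by the squared norm of
    \<open>u - x\<close>.\<close>
  have h0: "h u \<ge> 0" if "u \<in> X" for u
  proof (cases "u = x")
    case False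
    have "inner (u - x) e \<le> norm (u - x) * norm e"
      by (rule norm_cauchy_schwarz)
    also have "\<dots> \<le> norm (u - x) * norm (u - x)"
      using near[OF that False] by (intro mult_left_mono) (auto simp: e_def dist_norm norm_minus_commute)
    also have "\<dots> = inner (u - x) (u - x)"
      by (simp add: power2_norm_eq_inner flip: power2_eq_square)
    finally show ?thesis
      by (simp add: h_def e_def inner_diff_right inner_diff_left)
  qed (simp add: h_def)
  have "\<exists>u\<in>X. \<not> collinear {0, e, u - x}"
  proof (rule ccontr)
    assume "\<not> ?thesis"
    then have "\<exists>c. u - x = c *\<^sub>R e" if "u \<in> X" for u
      using that y by (auto simp: collinear_lemma e_def intro: exI[of _ 0])
    then have "X \<subseteq> range (\<lambda>c. x + c *\<^sub>R e)"
      by (metis (no_types, lifting) add.commute diff_add_cancel rangeI subsetI)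
    moreover have "collinear (range (\<lambda>c::real. x + c *\<^sub>R e))"
      unfolding collinear_def
      by (rule exI[of _ e]) (auto simp flip: scaleR_left_diff_distrib)
    ultimately show False
      using assms(3) collinear_subset by blast
  qed
  then obtain u0 where u0: "u0 \<in> X" "\<not> collinear {0, e, u0 - x}" by blast
  from exists_normal_off_line[OF u0(2)] obtain N where N: "inner e N = 0" "inner (u0 - x) N > 0" by blast
  define Y where "Y = {u \<in> X. inner (u - x) N > 0}"
  \<comment> \<open>The centre moves from the midpoint of \<open>xy\<close> by a multiple of
    \<open>N\<close>; \<open>t u\<close> is the multiple at which the circle through
    \<open>x\<close> and \<open>y\<close> meets \<open>u\<close>.\<close>
  define t where "t u = h u / (2 * inner (u - x) N)" for u
  have Y: "finite Y" "Y \<noteq> {}" using assms(1) u0 N by (auto simp: Y_def)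
  then obtain z where z: "z \<in> Y" and tmin: "\<And>u. u \<in> Y \<Longrightarrow> t z \<le> t u"
    using arg_min_if_finite[of Y t] by (metis linorder_not_le)
  have tz: "t z \<ge> 0" using z h0 by (auto simp: t_def Y_def)
  define c where "c = (1/2) *\<^sub>R (x + y) + t z *\<^sub>R N"
  \<comment> \<open>The power of \<open>u\<close> with respect to the moved circle is affine in the
    shift; its slope depends on the side of the line \<open>xy\<close> on which \<open>u\<close>
    lies.\<close>
  have power: "(dist c u)\<^sup>2 - (dist c x)\<^sup>2 = h u - 2 * t z * inner (u - x) N" for u
  proof -
    define a where "a = u - x"
    have cx: "c - x = (1/2) *\<^sub>R e + t z *\<^sub>R N"
      by (simp add: c_def e_def complex_eq_iff field_simps)
    have "(dist c u)\<^sup>2 - (dist c x)\<^sup>2 = inner (c - x - a) (c - x - a) - inner (c - x) (c - x)"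
      by (simp add: dist_norm power2_norm_eq_inner a_def)
    also have "\<dots> = inner a a - 2 * inner a (c - x)"
      by (simp add: inner_diff_left inner_diff_right inner_commute[of c a] inner_commute[of x a])
    also have "\<dots> = inner a (a - e) - 2 * t z * inner a N"
      unfolding cx by (simp add: inner_diff_right inner_add_right)
    also have "a - e = u - y" by (simp add: a_def e_def)
    finally show ?thesis by (simp add: h_def a_def)
  qed
  have in_sphere: "u \<in> sphere c (dist c x)" if "h u = 2 * t z * inner (u - x) N" for u
    using power[of u] that by (simp add: power2_eq_iff_nonneg)
  have "z \<in> sphere c (dist c x)"
    using z by (intro in_sphere) (simp add: t_def Y_def)
  moreover have "y \<in> sphere c (dist c x)"
    using N(1) by (intro in_sphere) (simp add: h_def e_def)
  moreover have "X \<inter> ball c (dist c x) = {}"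
  proof -
    have "2 * t z * inner (u - x) N \<le> h u" if u: "u \<in> X" for u
    proof (cases "inner (u - x) N > 0")
      case True
      then have "t z \<le> t u" using u by (intro tmin) (simp add: Y_def)
      with True show ?thesis by (simp add: t_def field_simps)
    next
      case False
      \<comment> \<open>On the other side of the line, and on the line, the shift cannot lower the
        power.\<close>
      then have "t z * inner (u - x) N \<le> 0" using tz by (simp add: mult_nonneg_nonpos)
      then show ?thesis using h0[OF u] by simp
    qed
    then have "(dist c x)\<^sup>2 \<le> (dist c u)\<^sup>2" if "u \<in> X" for u
      using power[of u] that by (smt (verit))
    then have "dist c x \<le> dist c u" if "u \<in> X" for u
      using that power2_le_imp_le zero_le_dist by blast
    then show ?thesis by fastforce
  qed
  moreover have "z \<in> X" "z \<noteq> x" "z \<noteq> y"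
    using z N(1) by (auto simp: Y_def e_def)
  ultimately show ?thesis
    using y by (intro exI[of _ y] exI[of _ z] exI[of _ c] exI[of _ "dist c x"]) auto
qed

text \<open>Consequence for faces: every labelled point belongs to the drawing and hence to no open
  face.\<close>

lemma delaunay_edge_at_label:
  assumes "inj_on P {1..n+3}" "\<not> collinear (P ` {1..n+3})" "v \<in> {1..n+3}"
  shows "\<exists>q. {v, q} \<in> delaunay_edges n P"
proof -
  obtain y z c \<rho> where "y \<in> P ` {1..n+3}" "z \<in> P ` {1..n+3}" "distinct [P v, y, z]"
    "{P v, y, z} \<subseteq> sphere c \<rho>" "P ` {1..n+3} \<inter> ball c \<rho> = {}"
    using exists_empty_circle_through[of "P ` {1..n+3}" "P v"] assms by blast
  moreover from this obtain q r where "q \<in> {1..n+3}" "r \<in> {1..n+3}" "y = P q" "z = P r"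
    by blast
  ultimately have "delaunay_triple n P v q r"
    using assms(3) unfolding delaunay_triple_def
    by (intro conjI exI[of _ c] exI[of _ \<rho>]) auto
  then show ?thesis
    unfolding delaunay_edges_def by blast
qed

text \<open>Two distinct points share a value for at most one slope \<open>s\<close>, so finitely
  many points exclude finitely many slopes. This provides the generic direction.\<close>

lemma exists_injective_functional:
  fixes X :: "complex set"
  assumes "finite X"
  shows "\<exists>s. inj_on (\<lambda>z. Re z + s * Im z) X"
proof -
  \<comment> \<open>Pairs with equal imaginary parts contribute only the harmless value 0 of a
    division by zero.\<close>
  define B where "B = (\<lambda>(u, w). (Re w - Re u) / (Im u - Im w)) ` (X \<times> X)"
  have "finite B" using assms by (simp add: B_def)
  then obtain s where s: "s \<notin> B"
    using ex_new_if_finite[OF infinite_UNIV_char_0] by blast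
  have "inj_on (\<lambda>z. Re z + s * Im z) X"
  proof (rule inj_onI, rule ccontr)
    fix u w assume uw: "u \<in> X" "w \<in> X" "Re u + s * Im u = Re w + s * Im w" "u \<noteq> w"
    then have "Im u \<noteq> Im w" by (auto simp: complex_eq_iff)
    with uw have "s = (Re w - Re u) / (Im u - Im w)" by (simp add: field_simps)
    with uw s show False by (force simp: B_def)
  qed
  then show ?thesis ..
qed

section \<open>Rays entering triangles\<close>

definition height :: "real \<Rightarrow> complex \<Rightarrow> real" where
  "height s z = Re z + s * Im z"

text \<open>It spans the kernel of \<open>height s\<close>, so rays along it stay at constant
  height.\<close>

definition level_dir :: "real \<Rightarrow> complex" where
  "level_dir s = Complex (- s) 1"

text \<open>Only a short initial piece of the ray counts and \<open>x\<close> itself is excluded, so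
  that a boundary point of a face can still see the face.\<close>

definition germ_in :: "complex \<Rightarrow> complex \<Rightarrow> complex set \<Rightarrow> bool" where
  "germ_in d x S \<longleftrightarrow> (\<forall>\<^sub>F \<epsilon> in at_right (0::real). x + \<epsilon> *\<^sub>R d \<in> S)"

lemma height_linear:
  "height s (x + y) = height s x + height s y"
  "height s (x - y) = height s x - height s y"
  "height s (k *\<^sub>R x) = k * height s x"
  by (simp_all add: height_def algebra_simps)

lemma height_level_dir [simp]: "height s (level_dir s) = 0" "height s (- level_dir s) = 0"
  by (simp_all add: height_def level_dir_def)

lemma level_dir_nonzero: "level_dir s \<noteq> 0" "level_dir s \<noteq> - level_dir s"
  by (simp_all add: level_dir_def complex_eq_iff)

lemma height_zero_imp_multiple: "height s z = 0 \<Longrightarrow> z = Im z *\<^sub>R level_dir s"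
  by (simp add: height_def level_dir_def complex_eq_iff mult.commute eq_neg_iff_add_eq_0)

lemma germ_in_mono: "germ_in d x S \<Longrightarrow> S \<subseteq> T \<Longrightarrow> germ_in d x T"
  unfolding germ_in_def by (auto elim: eventually_mono)

lemma germ_in_disjoint: "germ_in d x S \<Longrightarrow> germ_in d x T \<Longrightarrow> S \<inter> T \<noteq> {}"
proof
  assume g: "germ_in d x S" "germ_in d x T" and "S \<inter> T = {}"
  from g have "\<forall>\<^sub>F \<epsilon> in at_right (0::real). x + \<epsilon> *\<^sub>R d \<in> S \<inter> T"
    unfolding germ_in_def by (simp add: eventually_conj_iff)
  with \<open>S \<inter> T = {}\<close> show False by simp
qed

lemma germ_in_closure:
  assumes "germ_in d x S"
  shows "x \<in> closure S"
proof -
  have "((\<lambda>\<epsilon>. x + \<epsilon> *\<^sub>R d) \<longlongrightarrow> x + 0 *\<^sub>R d) (at_right 0)"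
    by (intro tendsto_intros)
  then show ?thesis
    using assms closure_approachable tendstoD unfolding germ_in_def
    by (smt (verit, ccfv_threshold) Lim_in_closed_set closed_closure closure_subset eventually_mono
        in_mono scaleR_zero_left add.right_neutral trivial_limit_at_right_real)
qed

lemma germ_in_open:
  assumes "open S" "x \<in> S"
  shows "germ_in d x S"
proof -
  have "((\<lambda>\<epsilon>. x + \<epsilon> *\<^sub>R d) \<longlongrightarrow> x + 0 *\<^sub>R d) (at_right 0)"
    by (intro tendsto_intros)
  then show ?thesis
    unfolding germ_in_def using assms topological_tendstoD by fastforce
qed

text \<open>The point is the midpoint of two points of the convex set. For a vertex of a triangle,
  which is not an interior point, this rules out two opposite entering rays.\<close>

lemma germ_in_opposite_convex:
  assumes "convex S" "germ_in d x S" "germ_in (- d) x S"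
  shows "x \<in> S"
proof -
  have "\<forall>\<^sub>F \<epsilon> in at_right (0::real). x \<in> S"
    using assms(2,3) unfolding germ_in_def
  proof eventually_elim
    case (elim \<epsilon>)
    have "(1/2) *\<^sub>R (x + \<epsilon> *\<^sub>R d) + (1/2) *\<^sub>R (x + \<epsilon> *\<^sub>R (- d)) \<in> S"
      using elim assms(1) by (intro convexD) auto
    moreover have "(1/2) *\<^sub>R (x + \<epsilon> *\<^sub>R d) + (1/2) *\<^sub>R (x + \<epsilon> *\<^sub>R (- d)) = x"
      by (simp add: complex_eq_iff field_simps)
    ultimately show ?case by simp
  qed
  then show ?thesis by simp
qed

text \<open>Only the vertex of middle height sees the interior along a level direction: at height
  \<open>height s B\<close> the opposite side is met in the point \<open>B + k *\<^sub>R level_dir s\<close>, and the sign of \<open>k\<close>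
  selects the direction.\<close>

lemma triangle_germ_sorted:
  assumes "height s A < height s B" "height s B < height s C" and nc: "\<not> collinear {A, B, C}"
  shows "\<exists>\<delta>\<^sub>0\<in>{level_dir s, - level_dir s}. \<forall>V\<in>{A, B, C}. \<forall>\<delta>\<in>{level_dir s, - level_dir s}.
    germ_in \<delta> V (interior (convex hull {A, B, C})) \<longleftrightarrow> V = B \<and> \<delta> = \<delta>\<^sub>0"
proof -
  define d where "d = level_dir s"
  let ?T = "interior (convex hull {A, B, C})"
  note T = interior_convex_hull_3_minimal[OF nc DIM_complex]
  \<comment> \<open>The position on \<open>AC\<close> at which the height equals that of
    \<open>B\<close>.\<close>
  define \<theta> where "\<theta> = (height s B - height s A) / (height s C - height s A)"
  have \<theta>: "0 < \<theta>" "\<theta> < 1" using assms(1,2) by (auto simp: \<theta>_def field_simps)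
  define B' where "B' = (1 - \<theta>) *\<^sub>R A + \<theta> *\<^sub>R C"
  define k where "k = Im (B' - B)"
  have "\<theta> * (height s C - height s A) = height s B - height s A"
    using assms(1,2) by (simp add: \<theta>_def)
  then have "height s (B' - B) = 0"
    by (simp add: B'_def height_linear algebra_simps)
  then have k: "B' - B = k *\<^sub>R d"
    unfolding d_def k_def by (rule height_zero_imp_multiple)
  have "k \<noteq> 0"
  proof
    assume "k = 0"
    then have "B = (1 - \<theta>) *\<^sub>R A + (1 - (1 - \<theta>)) *\<^sub>R C" using k by (simp add: B'_def)
    then show False using nc unfolding collinear_3_expand by blast
  qed
  \<comment> \<open>The sign makes the ray run from \<open>B\<close> towards
    \<open>B'\<close>.\<close>
  define \<delta> where "\<delta> = (if k > 0 then d else - d)"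
  have \<delta>: "\<delta> \<in> {d, - d}" "- \<delta> \<in> {d, - d}" by (auto simp: \<delta>_def)
  have k\<delta>: "k *\<^sub>R d = \<bar>k\<bar> *\<^sub>R \<delta>" by (auto simp: \<delta>_def)
  have B_in: "germ_in \<delta> B ?T"
    unfolding germ_in_def eventually_at_right_field
  proof (intro exI[of _ "\<bar>k\<bar>"] conjI allI impI)
    show "0 < \<bar>k\<bar>" using \<open>k \<noteq> 0\<close> by simp
    fix \<epsilon> :: real assume \<epsilon>: "0 < \<epsilon>" "\<epsilon> < \<bar>k\<bar>"
    \<comment> \<open>The fraction of the way from \<open>B\<close> to \<open>B'\<close>; strictly
      in between, all three barycentric coordinates are positive.\<close>
    define \<mu> where "\<mu> = \<epsilon> / \<bar>k\<bar>"
    have \<mu>: "0 < \<mu>" "\<mu> < 1" using \<epsilon> by (auto simp: \<mu>_def)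
    have "\<epsilon> *\<^sub>R \<delta> = \<mu> *\<^sub>R (B' - B)"
      using \<open>k \<noteq> 0\<close> by (simp add: k k\<delta> \<mu>_def)
    then have "B + \<epsilon> *\<^sub>R \<delta> = (\<mu> * (1 - \<theta>)) *\<^sub>R A + (1 - \<mu>) *\<^sub>R B + (\<mu> * \<theta>) *\<^sub>R C"
      by (simp add: B'_def algebra_simps)
    moreover have "0 < \<mu> * (1 - \<theta>)" "0 < 1 - \<mu>" "0 < \<mu> * \<theta>"
      "\<mu> * (1 - \<theta>) + (1 - \<mu>) + \<mu> * \<theta> = 1"
      using \<mu> \<theta> by (auto simp: algebra_simps)
    ultimately show "B + \<epsilon> *\<^sub>R \<delta> \<in> ?T" unfolding T by fastforce
  qed
  have "B \<notin> ?T"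
  proof
    assume "B \<in> ?T"
    moreover have "?T = convex hull {A, B, C} - (closed_segment A B \<union> closed_segment B C \<union> closed_segment C A)"
      by (rule interior_of_triangle) simp
    ultimately show False by auto
  qed
  then have B_out: "\<not> germ_in (- \<delta>) B ?T"
    using B_in germ_in_opposite_convex[of ?T \<delta> B] by (auto simp: convex_interior)
  \<comment> \<open>Positive barycentric coordinates put interior points strictly between the
    extreme heights, whereas a level ray from \<open>A\<close> or \<open>C\<close> stays at an
    extreme height.\<close>
  have heights: "height s A < height s z \<and> height s z < height s C" if "z \<in> ?T" for z
  proof -
    from that obtain x y w where xyw: "0 < x" "0 < y" "0 < w" "x + y + w = 1"
      "z = x *\<^sub>R A + y *\<^sub>R B + w *\<^sub>R C" unfolding T by blast
    have x: "x = 1 - y - w" using xyw by simp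
    have "height s z - height s A = y * (height s B - height s A) + w * (height s C - height s A)"
      by (simp add: xyw(5) height_linear x algebra_simps)
    moreover have "\<dots> > 0" using xyw assms(1,2) by (intro add_pos_pos mult_pos_pos) auto
    moreover have w: "w = 1 - x - y" using xyw by simp
    have "height s C - height s z = x * (height s C - height s A) + y * (height s C - height s B)"
      unfolding xyw(5) height_linear by (simp add: w algebra_simps)
    moreover have "\<dots> > 0" using xyw assms(1,2) by (intro add_pos_pos mult_pos_pos) auto
    ultimately show ?thesis by linarith
  qed
  have extreme_out: "\<not> germ_in \<delta>' V ?T" if V: "V \<in> {A, C}" and "\<delta>' \<in> {d, - d}" for V \<delta>'
  proof
    assume "germ_in \<delta>' V ?T"
    then have "\<forall>\<^sub>F \<epsilon> in at_right (0::real). V + \<epsilon> *\<^sub>R \<delta>' \<in> ?T" by (simp add: germ_in_def)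
    then obtain \<epsilon> :: real where "V + \<epsilon> *\<^sub>R \<delta>' \<in> ?T"
      using eventually_happens'[OF trivial_limit_at_right_real] by blast
    then have "height s A < height s V \<and> height s V < height s C"
      using heights[of "V + \<epsilon> *\<^sub>R \<delta>'"] that(2) by (auto simp: height_linear d_def)
    then show False using V by auto
  qed
  have ne: "A \<noteq> B" "C \<noteq> B" using assms(1,2) by auto
  have "germ_in \<delta>' V ?T \<longleftrightarrow> V = B \<and> \<delta>' = \<delta>" if "V \<in> {A, B, C}" "\<delta>' \<in> {d, - d}" for V \<delta>'
  proof (cases "V = B")
    case True
    have "\<delta>' = \<delta> \<or> \<delta>' = - \<delta>" using that(2) by (auto simp: \<delta>_def)
    moreover have "\<delta> \<noteq> - \<delta>" using level_dir_nonzero(2)[of s] by (auto simp: \<delta>_def d_def)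
    ultimately show ?thesis using True B_in B_out by auto
  next
    case False
    then show ?thesis using extreme_out that by auto
  qed
  then show ?thesis using \<delta>(1) unfolding d_def by blast
qed

lemma triangle_germ:
  assumes "inj_on (height s) {A, B, C}" and nc: "\<not> collinear {A, B, C}"
  shows "\<exists>V\<^sub>0\<in>{A, B, C}. \<exists>\<delta>\<^sub>0\<in>{level_dir s, - level_dir s}.
    \<forall>V\<in>{A, B, C}. \<forall>\<delta>\<in>{level_dir s, - level_dir s}.
    germ_in \<delta> V (interior (convex hull {A, B, C})) \<longleftrightarrow> V = V\<^sub>0 \<and> \<delta> = \<delta>\<^sub>0"
proof -
  have "A \<noteq> B" "A \<noteq> C" "B \<noteq> C" using nc by (auto simp: insert_commute)
  then have "height s A \<noteq> height s B" "height s A \<noteq> height s C" "height s B \<noteq> height s C"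
    using assms(1) by (auto simp: inj_on_def)
  then have "\<exists>A' B' C'. {A, B, C} = {A', B', C'} \<and> height s A' < height s B' \<and> height s B' < height s C'"
    by (smt (verit, ccfv_threshold) insert_commute)
  then obtain A' B' C' where eq: "{A, B, C} = {A', B', C'}"
    and lt: "height s A' < height s B'" "height s B' < height s C'" by blast
  show ?thesis
    unfolding eq using triangle_germ_sorted[OF lt] nc unfolding eq by blast
qed

text \<open>The ray is level and the segment is not, so their lines meet at most once, and a short
  enough piece of the ray misses that point.\<close>

lemma germ_avoids_segment:
  assumes "height s p \<noteq> height s q" "\<delta> \<in> {level_dir s, - level_dir s}"
  shows "germ_in \<delta> x (- closed_segment p q)"
proof -
  have \<delta>: "height s \<delta> = 0" "\<delta> \<noteq> 0" using assms(2) level_dir_nonzero by auto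
  have "e = e'" if e: "x + e *\<^sub>R \<delta> \<in> closed_segment p q" "x + e' *\<^sub>R \<delta> \<in> closed_segment p q" for e e'
  proof -
    obtain u u' where u: "x + e *\<^sub>R \<delta> = (1 - u) *\<^sub>R p + u *\<^sub>R q" "x + e' *\<^sub>R \<delta> = (1 - u') *\<^sub>R p + u' *\<^sub>R q"
      using e unfolding closed_segment_def by blast
    have "(1 - u) * height s p + u * height s q = (1 - u') * height s p + u' * height s q"
      using arg_cong[OF u(1), of "height s"] arg_cong[OF u(2), of "height s"]
      by (simp add: height_linear \<delta>)
    then have "(u - u') * (height s q - height s p) = 0" by (simp add: algebra_simps)
    then have "u = u'" using assms(1) by simp
    with u have "e *\<^sub>R \<delta> = e' *\<^sub>R \<delta>" by (metis add_left_cancel)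
    then show ?thesis using \<delta> by simp
  qed
  then obtain e\<^sub>0 where e\<^sub>0: "\<And>e. x + e *\<^sub>R \<delta> \<in> closed_segment p q \<Longrightarrow> e = e\<^sub>0" by metis
  have "\<forall>\<^sub>F e in at_right (0::real). e \<noteq> e\<^sub>0"
  proof (cases "e\<^sub>0 > 0")
    case True
    then show ?thesis unfolding eventually_at_right_field by (intro exI[of _ e\<^sub>0]) auto
  next
    \<comment> \<open>No positive parameter is excluded here, so any bound serves; in particular the
      segment may start at \<open>x\<close>.\<close>
    case False
    then show ?thesis unfolding eventually_at_right_field by (intro exI[of _ 1]) auto
  qed
  then show ?thesis
    unfolding germ_in_def by eventually_elim (use e\<^sub>0 in auto)
qed

text \<open>An initial piece of the ray is connected, so it lies in a single component.\<close>

lemma germ_in_component: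
  assumes "germ_in d x S"
  shows "\<exists>C\<in>components S. germ_in d x C"
proof -
  obtain r where r: "0 < r" "\<And>e. 0 < e \<Longrightarrow> e < r \<Longrightarrow> x + e *\<^sub>R d \<in> S"
    using assms unfolding germ_in_def eventually_at_right_field by blast
  let ?R = "(\<lambda>e. x + e *\<^sub>R d) ` {0<..<r}"
  have "connected ?R"
    by (intro connected_continuous_image continuous_intros) simp
  moreover have "?R \<subseteq> S" using r(2) by auto
  moreover have "S \<noteq> {}" using r(1) r(2)[of "r/2"] by auto
  ultimately obtain C where C: "C \<in> components S" "?R \<subseteq> C"
    using exists_component_superset by blast
  have "germ_in d x C"
    unfolding germ_in_def eventually_at_right_field using C(2) r(1)
    by (intro exI[of _ r]) (auto simp: image_subset_iff)
  then show ?thesis using C(1) by blast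
qed

section \<open>The number of faces\<close>

text \<open>Allows faces to be counted through the relation that a ray enters a face, without an
  explicit map.\<close>

lemma card_eq_if_unique_partners:
  assumes "\<And>x. x \<in> A \<Longrightarrow> \<exists>!y. y \<in> B \<and> R x y" "\<And>y. y \<in> B \<Longrightarrow> \<exists>!x. x \<in> A \<and> R x y"
  shows "card A = card B"
proof -
  from assms(1) obtain f where f: "\<And>x. x \<in> A \<Longrightarrow> f x \<in> B \<and> R x (f x)" by metis
  have "inj_on f A"
    using f assms(2) by (intro inj_onI) metis
  moreover have "f ` A = B"
  proof
    show "f ` A \<subseteq> B" using f by auto
    show "B \<subseteq> f ` A"
    proof
      fix y assume "y \<in> B"
      then obtain x where "x \<in> A" "R x y" using assms(2) by blast
      then show "y \<in> f ` A" using f[of x] assms(1)[of x] \<open>y \<in> B\<close> by blast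
    qed
  qed
  ultimately show ?thesis by (metis card_image)
qed

section \<open>Triangular faces of the Delaunay graph\<close>

lemma delaunay_edges_labels: "{p, q} \<in> delaunay_edges n P \<Longrightarrow> p \<in> {1..n+3} \<and> q \<in> {1..n+3}"
  unfolding delaunay_edges_def delaunay_triple_def by (auto simp: doubleton_eq_iff)

lemma finite_delaunay_edges: "finite (delaunay_edges n P)"
proof (rule finite_subset)
  show "delaunay_edges n P \<subseteq> Pow {1..n+3}"
    unfolding delaunay_edges_def delaunay_triple_def by auto
qed simp

lemma triangular_facesE:
  assumes "t \<in> triangular_faces P H"
  obtains p q r where "t = {p, q, r}" "distinct [p, q, r]" "{p, q} \<in> H" "{q, r} \<in> H" "{p, r} \<in> H"
    "interior (convex hull (P ` t)) \<in> components (- drawing P H)"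
  using assms unfolding triangular_faces_def by auto

lemma triangular_faces_labels:
  assumes "t \<in> triangular_faces P (delaunay_edges n P)"
  shows "t \<subseteq> {1..n+3}"
  using assms by (elim triangular_facesE) (auto dest: delaunay_edges_labels)

text \<open>A component is nonempty, whereas the hull of points on a line has empty
  interior.\<close>

lemma triangular_face_not_collinear:
  assumes "{p, q, r} \<in> triangular_faces P H"
  shows "\<not> collinear {P p, P q, P r}"
proof
  assume col: "collinear {P p, P q, P r}"
  have "interior (convex hull (P ` {p, q, r})) \<in> components (- drawing P H)"
    using assms by (rule triangular_facesE)
  then have int: "interior (convex hull {P p, P q, P r}) \<noteq> {}"
    using in_components_nonempty by auto
  from col obtain u v where "{P p, P q, P r} \<subseteq> affine hull {u, v}"
    unfolding collinear_affine_hull by blast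
  then have "convex hull {P p, P q, P r} \<subseteq> affine hull {u, v}"
    by (meson affine_affine_hull affine_imp_convex hull_minimal)
  moreover have "interior (affine hull {u, v}) = {}"
    by (rule empty_interior_affine_hull) (auto simp: card_insert_if)
  ultimately show False using int interior_mono by blast
qed

text \<open>Labelled points lie on the drawing, so one in the closed triangle is on a side, where
  only the endpoints are possible.\<close>

lemma face_contains_only_its_vertices:
  assumes inj: "inj_on P {1..n+3}" and nc: "\<not> collinear (P ` {1..n+3})"
    and t: "t \<in> triangular_faces P (delaunay_edges n P)"
    and v: "v \<in> {1..n+3}" "P v \<in> convex hull (P ` t)"
  shows "v \<in> t"
proof -
  from t obtain p q r where pqr: "t = {p, q, r}" "{p, q} \<in> delaunay_edges n P"
    "{q, r} \<in> delaunay_edges n P" "{p, r} \<in> delaunay_edges n P"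
    and comp: "interior (convex hull (P ` t)) \<in> components (- drawing P (delaunay_edges n P))"
    by (elim triangular_facesE) blast
  obtain w where "{v, w} \<in> delaunay_edges n P"
    using delaunay_edge_at_label[OF inj nc v(1)] by blast
  then have "P v \<in> drawing P (delaunay_edges n P)"
    unfolding drawing_def by (auto intro!: bexI[of _ "{v, w}"] simp: hull_inc)
  then have "P v \<notin> interior (convex hull (P ` t))"
    using in_components_subset[OF comp] by blast
  then have "P v \<in> closed_segment (P p) (P q) \<union> closed_segment (P q) (P r) \<union> closed_segment (P r) (P p)"
    using v(2) interior_of_triangle[of "P p" "P q" "P r"] by (auto simp: pqr(1))
  then show ?thesis
    using delaunay_edge_endpoint[OF inj pqr(2) v(1)] delaunay_edge_endpoint[OF inj pqr(3) v(1)]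
      delaunay_edge_endpoint[OF inj pqr(4) v(1)]
    by (auto simp: pqr(1) closed_segment_commute)
qed

theorem card_triangular_faces:
  assumes "realizes n a b c pa pb pc P H" "{a, b, c} \<subseteq> {1..n+3}" "distinct [a, b, c]"
    and nc: "\<not> collinear {pa, pb, pc}"
  shows "card (triangular_faces P H) = 2 * n + 1"
proof -
  define L where "L = {1..n+3}"
  define T where "T = convex hull {pa, pb, pc}"
  define F where "F = triangular_faces P H"
  from assms(1) have inj: "inj_on P L" and abc: "P a = pa" "P b = pb" "P c = pc"
    and inner: "\<And>v. v \<in> L - {a, b, c} \<Longrightarrow> P v \<in> interior T"
    and H: "H = delaunay_edges n P"
    and comps: "components (- drawing P H) = insert (- T) ((\<lambda>t. interior (convex hull (P ` t))) ` F)"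
    unfolding realizes_def configuration_def strict_with_outer_face_def L_def T_def F_def by auto
  have finH: "finite H" by (simp add: H finite_delaunay_edges)
  have abcL: "{a, b, c} \<subseteq> L" using assms(2) by (simp add: L_def)
  have ncP: "\<not> collinear (P ` L)"
  proof
    assume "collinear (P ` L)"
    moreover have "{pa, pb, pc} \<subseteq> P ` L" using abc abcL by auto
    ultimately show False using nc collinear_subset by blast
  qed
  obtain s where "inj_on (\<lambda>z. Re z + s * Im z) (P ` L)"
    using exists_injective_functional[of "P ` L"] by (auto simp: L_def)
  then have hinj: "inj_on (height s) (P ` L)" by (simp add: height_def[abs_def])
  define D where "D = {level_dir s, - level_dir s}"
  have cardD: "card D = 2" using level_dir_nonzero(2)[of s] by (simp add: D_def)
  define S where "S = {(v, \<delta>). v \<in> L \<and> \<delta> \<in> D \<and> germ_in \<delta> (P v) (interior T)}"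
  define R where "R x t \<longleftrightarrow> germ_in (snd x) (P (fst x)) (interior (convex hull (P ` t)))"
    for x :: "nat \<times> complex" and t
  have only: "v \<in> t" if "t \<in> F" "v \<in> L" "P v \<in> convex hull (P ` t)" for v t
    using face_contains_only_its_vertices inj ncP that unfolding L_def F_def H by blast
  have FL: "t \<subseteq> L" if "t \<in> F" for t
    using triangular_faces_labels that unfolding F_def H L_def by blast
  have Fcomp: "interior (convex hull (P ` t)) \<in> components (- drawing P H)" if "t \<in> F" for t
    using that comps by blast
  \<comment> \<open>A closed convex set with nonempty interior is the closure of that interior, so
    an open face determines its closed triangle.\<close>
  have closure_face: "closure (interior (convex hull (P ` t))) = convex hull (P ` t)" if "t \<in> F" for t
  proof -
    have "finite t" using FL[OF that] finite_subset by (auto simp: L_def)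
    then have "closed (convex hull (P ` t))"
      by (simp add: compact_imp_closed finite_imp_compact_convex_hull)
    then show ?thesis
      using convex_closure_interior[of "convex hull (P ` t)"] in_components_nonempty[OF Fcomp[OF that]]
      by (simp add: closure_closed)
  qed
  \<comment> \<open>The labels of a face are recovered as the labelled points in the closed
    triangle.\<close>
  have face_inj: "t = t'" if "t \<in> F" "t' \<in> F"
    "interior (convex hull (P ` t)) = interior (convex hull (P ` t'))" for t t'
  proof -
    have eq: "convex hull (P ` t) = convex hull (P ` t')"
      using closure_face that by metis
    have "t \<subseteq> t'" using only[OF that(2)] FL[OF that(1)] eq by (metis hull_inc image_eqI subsetD subsetI)
    moreover have "t' \<subseteq> t" using only[OF that(1)] FL[OF that(2)] eq by (metis hull_inc image_eqI subsetD subsetI)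
    ultimately show ?thesis by blast
  qed
  have bounded_T: "bounded T" by (simp add: T_def bounded_convex_hull)
  \<comment> \<open>A bounded component differs from the unbounded \<open>- T\<close>, and distinct
    components are disjoint.\<close>
  have face_inside: "interior (convex hull (P ` t)) \<subseteq> interior T" if "t \<in> F" for t
  proof -
    have "bounded (interior (convex hull (P ` t)))"
      using FL[OF that] by (intro bounded_interior bounded_convex_hull finite_imp_bounded finite_imageI)
        (auto simp: L_def intro: finite_subset)
    then have "interior (convex hull (P ` t)) \<noteq> - T"
      using bounded_T cobounded_imp_unbounded by metis
    moreover have "- T \<in> components (- drawing P H)" using comps by blast
    ultimately have "interior (convex hull (P ` t)) \<inter> - T = {}"
      using components_nonoverlap Fcomp[OF that] by blast
    then show ?thesis by (intro interior_maximal) auto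
  qed
  \<comment> \<open>By the choice of \<open>s\<close> no edge is level, so each of the finitely many
    edges leaves an initial piece of the ray free.\<close>
  have ray: "\<exists>C\<in>components (- drawing P H). germ_in \<delta> (P v) C" if "v \<in> L" "\<delta> \<in> D" for v \<delta>
  proof (rule germ_in_component)
    have "germ_in \<delta> (P v) (- (convex hull (P ` e)))" if "e \<in> H" for e
    proof -
      obtain p q r where e: "e = {p, q}" and "delaunay_triple n P p q r"
        using \<open>e \<in> H\<close> unfolding H delaunay_edges_def by blast
      then have "p \<in> L" "q \<in> L" "p \<noteq> q" unfolding delaunay_triple_def L_def by auto
      then have "height s (P p) \<noteq> height s (P q)"
        using inj hinj by (meson image_eqI inj_onD)
      then show ?thesis
        using germ_avoids_segment \<open>\<delta> \<in> D\<close> unfolding D_def e by (simp add: segment_convex_hull)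
    qed
    then have "\<forall>\<^sub>F \<epsilon> in at_right 0. \<forall>e\<in>H. P v + \<epsilon> *\<^sub>R \<delta> \<in> - (convex hull (P ` e))"
      unfolding germ_in_def using finH by (simp add: eventually_ball_finite_distrib)
    then show "germ_in \<delta> (P v) (- drawing P H)"
      unfolding germ_in_def drawing_def by eventually_elim auto
  qed
  have "card S = card F"
  proof (rule card_eq_if_unique_partners[where R = R])
    fix x assume "x \<in> S"
    then obtain v \<delta> where x: "x = (v, \<delta>)" "v \<in> L" "\<delta> \<in> D" "germ_in \<delta> (P v) (interior T)"
      by (auto simp: S_def)
    obtain C where C: "C \<in> components (- drawing P H)" "germ_in \<delta> (P v) C"
      using ray x by blast
    \<comment> \<open>The ray also enters the interior of \<open>T\<close>, which rules out the
      outer component.\<close>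
    have "C \<noteq> - T"
      using germ_in_disjoint[OF C(2) x(4)] interior_subset[of T] by auto
    then obtain t where t: "t \<in> F" "C = interior (convex hull (P ` t))"
      using C(1) comps by auto
    show "\<exists>!t. t \<in> F \<and> R x t"
    proof (rule ex1I[of _ t])
      show "t \<in> F \<and> R x t" using t C(2) by (simp add: R_def x)
      fix t' assume t': "t' \<in> F \<and> R x t'"
      then have "germ_in \<delta> (P v) (interior (convex hull (P ` t')))" by (simp add: R_def x)
      from germ_in_disjoint[OF C(2) this] show "t' = t"
        using components_nonoverlap[OF C(1) Fcomp[of t']] t' t face_inj by metis
    qed
  next
    fix t assume t: "t \<in> F"
    then obtain p q r where pqr: "t = {p, q, r}" unfolding F_def by (elim triangular_facesE)
    have img: "P ` t = {P p, P q, P r}" by (simp add: pqr)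
    have tL: "t \<subseteq> L" by (rule FL[OF t])
    have "\<not> collinear {P p, P q, P r}"
      using triangular_face_not_collinear t unfolding F_def pqr by blast
    moreover have "inj_on (height s) {P p, P q, P r}"
      by (rule inj_on_subset[OF hinj]) (use tL pqr in auto)
    ultimately have "\<exists>V\<in>P ` t. \<exists>\<delta>\<in>D. \<forall>V'\<in>P ` t. \<forall>\<delta>'\<in>D.
        germ_in \<delta>' V' (interior (convex hull (P ` t))) \<longleftrightarrow> V' = V \<and> \<delta>' = \<delta>"
      unfolding D_def img by (intro triangle_germ)
    then obtain V \<delta> where V: "V \<in> P ` t" "\<delta> \<in> D"
      and "\<forall>V'\<in>P ` t. \<forall>\<delta>'\<in>D.
        germ_in \<delta>' V' (interior (convex hull (P ` t))) \<longleftrightarrow> V' = V \<and> \<delta>' = \<delta>"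
      by (elim bexE)
    then have germ: "germ_in \<delta>' V' (interior (convex hull (P ` t))) \<longleftrightarrow> V' = V \<and> \<delta>' = \<delta>"
      if "V' \<in> P ` t" "\<delta>' \<in> D" for V' \<delta>' using that by blast
    from V(1) obtain v where v: "v \<in> t" "V = P v" by blast
    show "\<exists>!x. x \<in> S \<and> R x t"
    proof (rule ex1I[of _ "(v, \<delta>)"])
      have g: "germ_in \<delta> (P v) (interior (convex hull (P ` t)))" using germ v V by auto
      with germ_in_mono[OF g face_inside[OF t]] show "(v, \<delta>) \<in> S \<and> R (v, \<delta>) t"
        using v tL V(2) by (auto simp: S_def R_def)
      fix x assume "x \<in> S \<and> R x t"
      then obtain v' \<delta>' where x: "x = (v', \<delta>')" "v' \<in> L" "\<delta>' \<in> D"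
        "germ_in \<delta>' (P v') (interior (convex hull (P ` t)))"
        by (auto simp: S_def R_def)
      \<comment> \<open>An entering ray starts in the closed triangle, hence at one of its vertices,
        where \<open>germ\<close> identifies it.\<close>
      have "P v' \<in> convex hull (P ` t)"
        using germ_in_closure[OF x(4)] closure_face[OF t] by simp
      then have "v' \<in> t" using only[OF t x(2)] by simp
      then have "P v' = P v" "\<delta>' = \<delta>" using germ[of "P v'" \<delta>'] x v by auto
      then show "x = (v, \<delta>)" using x inj v tL by (auto dest: inj_onD)
    qed
  qed
  moreover have "card S = 2 * n + 1"
  proof -
    have "inj_on (height s) {pa, pb, pc}"
      by (rule inj_on_subset[OF hinj]) (use abc abcL in auto)
    from triangle_germ[OF this nc] obtain V \<delta> where V: "V \<in> {pa, pb, pc}" "\<delta> \<in> D"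
      and germ: "\<And>V' \<delta>'. V' \<in> {pa, pb, pc} \<Longrightarrow> \<delta>' \<in> D \<Longrightarrow>
        germ_in \<delta>' V' (interior T) \<longleftrightarrow> V' = V \<and> \<delta>' = \<delta>"
      unfolding D_def T_def by blast
    obtain v where v: "v \<in> {a, b, c}" "V = P v" using V(1) abc by auto
    have corner: "germ_in \<delta>' (P v') (interior T) \<longleftrightarrow> v' = v \<and> \<delta>' = \<delta>" if "v' \<in> {a, b, c}" "\<delta>' \<in> D" for v' \<delta>'
    proof -
      have "P v' \<in> {pa, pb, pc}" using that(1) abc by auto
      moreover have "P v' = P v \<longleftrightarrow> v' = v"
        using inj that(1) v(1) abcL by (auto dest: inj_onD)
      ultimately show ?thesis using germ that(2) v(2) by auto
    qed
    have "S = insert (v, \<delta>) ((L - {a, b, c}) \<times> D)"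
    proof (rule Set.set_eqI)
      fix x :: "nat \<times> complex"
      obtain v' \<delta>' where x: "x = (v', \<delta>')" by (cases x)
      show "x \<in> S \<longleftrightarrow> x \<in> insert (v, \<delta>) ((L - {a, b, c}) \<times> D)"
      proof (cases "v' \<in> {a, b, c}")
        case True
        then show ?thesis using corner[of v' \<delta>'] V(2) abcL by (auto simp: S_def x)
      next
        case False
        then show ?thesis
          using v(1) germ_in_open[of "interior T" "P v'" \<delta>'] inner[of v'] by (auto simp: S_def x)
      qed
    qed
    moreover have "(v, \<delta>) \<notin> (L - {a, b, c}) \<times> D" using v(1) by auto
    moreover have "finite ((L - {a, b, c}) \<times> D)" by (simp add: L_def D_def)
    moreover have "card (L - {a, b, c}) = n"
      using abcL assms(3) by (subst card_Diff_subset) (auto simp: L_def)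
    ultimately show ?thesis by (simp add: card_cartesian_product cardD)
  qed
  ultimately show ?thesis by (simp add: F_def)
qed

section \<open>The flip map in coordinates\<close>

lemma not_in_pairI: "v \<in> t \<Longrightarrow> v \<notin> A \<Longrightarrow> v \<notin> B \<Longrightarrow> t \<notin> {A, B}"
  by auto

locale flip_groupoid =
  fixes n a b c :: nat and pa pb pc :: complex and \<zeta> :: "nat \<Rightarrow> rat"
  assumes outer_labels: "{a, b, c} \<subseteq> {1..n+3}" "distinct [a, b, c]"
    and outer_not_collinear: "\<not> collinear {pa, pb, pc}"
    and inj_\<zeta>: "inj_on \<zeta> {1..n+3}"
begin

abbreviation "Objects \<equiv> triangulations n a b c pa pb pc"
abbreviation "Tri \<equiv> triangles n a b c pa pb pc"
abbreviation "is_flip \<equiv> flip n a b c pa pb pc"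
abbreviation "gen \<equiv> generator n a b c pa pb pc"
abbreviation "\<Gamma> \<equiv> gamma n a b c pa pb pc \<zeta>"
abbreviation "tri_basis \<equiv> ordered_basis n a b c pa pb pc"
abbreviation "F_mat \<equiv> flip_matrix n a b c pa pb pc \<zeta>"
abbreviation "W_mat \<equiv> word_matrix n a b c pa pb pc \<zeta>"
abbreviation "word \<equiv> is_word n a b c pa pb pc"
abbreviation "equiv_words \<equiv> word_equiv n a b c pa pb pc"

text \<open>\<open>Tri H\<close> is defined through one chosen realization; obtaining exactly that
  \<open>P\<close> makes the geometric results available for it.\<close>

lemma triangulation_realized:
  assumes "H \<in> Objects"
  obtains P where "realizes n a b c pa pb pc P H" "Tri H = triangular_faces P H" "H = delaunay_edges n P"
proof -
  let ?P = "SOME P. realizes n a b c pa pb pc P H"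
  have "\<exists>P. realizes n a b c pa pb pc P H" using assms by (simp add: triangulations_def)
  then have "realizes n a b c pa pb pc ?P H" by (rule someI_ex)
  then show ?thesis by (intro that[of ?P]) (auto simp: triangles_def realizes_def)
qed

lemma card_triangles: "H \<in> Objects \<Longrightarrow> card (Tri H) = 2 * n + 1"
  by (metis card_triangular_faces outer_labels outer_not_collinear triangulation_realized)

lemma finite_triangles: "H \<in> Objects \<Longrightarrow> finite (Tri H)"
  using card_triangles card.infinite by fastforce

lemma triangle_labels:
  assumes "H \<in> Objects" "t \<in> Tri H"
  shows "t \<subseteq> {1..n+3}"
  by (metis assms triangulation_realized triangular_faces_labels)

lemma triangle_edge:
  assumes "H \<in> Objects" "t \<in> Tri H" "u \<in> t" "v \<in> t" "u \<noteq> v"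
  shows "{u, v} \<in> H"
proof -
  obtain P where "t \<in> triangular_faces P H" using assms(1,2) by (metis triangulation_realized)
  then obtain p q r where "t = {p, q, r}" "{p, q} \<in> H" "{q, r} \<in> H" "{p, r} \<in> H"
    by (rule triangular_facesE)
  then show ?thesis using assms(3-5) by (auto simp: insert_commute)
qed

section \<open>Combinatorics and coordinates of a single flip\<close>

context
  fixes i j k l H H'
  assumes flip: "is_flip i j k l H H'"
begin

lemma flip_objects: "H \<in> Objects" "H' \<in> Objects"
  and flip_distinct: "distinct [i, j, k, l]"
  and flip_old: "{i, j, k} \<in> Tri H" "{i, k, l} \<in> Tri H"
  and flip_edges: "{j, l} \<notin> H" "H' = H - {{i, k}} \<union> {{j, l}}"
  and flip_triangles: "Tri H' = Tri H - {{i, j, k}, {i, k, l}} \<union> {{i, j, l}, {j, k, l}}"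
  using flip unfolding flip_def by blast+

lemma flip_new: "{i, j, l} \<in> Tri H'" "{j, k, l} \<in> Tri H'"
  using flip_triangles by auto

lemma flip_removed_edge: "{i, k} \<in> H" "{i, k} \<notin> H'"
proof -
  have d: "distinct [i, j, k, l]" by (rule flip_distinct)
  show "{i, k} \<in> H" using triangle_edge[OF flip_objects(1) flip_old(1), of i k] d by simp
  show "{i, k} \<notin> H'" using flip_edges(2) d by (auto simp: doubleton_eq_iff)
qed

text \<open>Each new triangle has the side \<open>jl\<close>, which is not an edge of
  \<open>H\<close>.\<close>

lemma flip_new_not_old: "{i, j, l} \<notin> Tri H" "{j, k, l} \<notin> Tri H"
  using triangle_edge[OF flip_objects(1), of _ j l] flip_edges(1) flip_distinct by auto

lemma flip_old_not_new: "{i, j, k} \<notin> Tri H'" "{i, k, l} \<notin> Tri H'"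
  using triangle_edge[OF flip_objects(2), of _ i k] flip_removed_edge(2) flip_distinct by auto

lemma flip_zeta: "\<zeta> i \<noteq> \<zeta> j" "\<zeta> i \<noteq> \<zeta> k" "\<zeta> i \<noteq> \<zeta> l" "\<zeta> j \<noteq> \<zeta> k" "\<zeta> j \<noteq> \<zeta> l" "\<zeta> k \<noteq> \<zeta> l"
proof -
  have "{i, j, k, l} \<subseteq> {1..n+3}"
    using triangle_labels[OF flip_objects(1) flip_old(1)] triangle_labels[OF flip_objects(1) flip_old(2)]
    by auto
  then show "\<zeta> i \<noteq> \<zeta> j" "\<zeta> i \<noteq> \<zeta> k" "\<zeta> i \<noteq> \<zeta> l" "\<zeta> j \<noteq> \<zeta> k" "\<zeta> j \<noteq> \<zeta> l" "\<zeta> k \<noteq> \<zeta> l"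
    using flip_distinct by (simp_all add: inj_on_eq_iff[OF inj_\<zeta>])
qed

text \<open>Reading the quadrilateral from \<open>j\<close> on exchanges the roles of the two
  diagonals.\<close>

lemma flip_reverse: "is_flip j k l i H' H"
proof -
  have d: "distinct [i, j, k, l]" by (rule flip_distinct)
  have "H = H' - {{j, l}} \<union> {{k, i}}"
    using flip_edges flip_removed_edge d by (auto simp: insert_commute)
  moreover have "Tri H = Tri H' - {{j, k, l}, {j, l, i}} \<union> {{j, k, i}, {k, l, i}}"
    using flip_triangles flip_new_not_old flip_old by (auto simp: insert_commute)
  ultimately show ?thesis
    unfolding flip_def using d flip_objects flip_new flip_removed_edge(2)
    by (simp add: insert_commute)
qed

text \<open>\<open>gamma_basis\<close> orders the endpoints of both diagonals by size. The formulas
  are symmetric under exchanging \<open>i\<close> with \<open>k\<close> and \<open>j\<close> with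
  \<open>l\<close>, so every naming of the quadrilateral gives the same map.\<close>

lemma gamma_basis_flip:
  "gamma_basis \<zeta> H H' t =
    (if t = {i, j, k} then
       (\<lambda>t'. (\<zeta> i - \<zeta> l) / (\<zeta> i - \<zeta> k) * basis_vector {i, j, l} t'
           + (\<zeta> l - \<zeta> k) / (\<zeta> i - \<zeta> k) * basis_vector {j, k, l} t')
     else if t = {i, k, l} then
       (\<lambda>t'. (\<zeta> i - \<zeta> j) / (\<zeta> i - \<zeta> k) * basis_vector {i, j, l} t'
           + (\<zeta> j - \<zeta> k) / (\<zeta> i - \<zeta> k) * basis_vector {j, k, l} t')
     else basis_vector t)"
proof -
  have d: "distinct [i, j, k, l]" by (rule flip_distinct)
  have ne: "H' \<noteq> H" using flip_removed_edge by auto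
  have del: "H - H' = {{i, k}}" and add: "H' - H = {{j, l}}"
    using flip_edges flip_removed_edge by auto
  \<comment> \<open>Exchanging \<open>i\<close> and \<open>k\<close> negates numerator and
    denominator.\<close>
  have swap: "(x - y) / (\<zeta> k - \<zeta> i) = (y - x) / (\<zeta> i - \<zeta> k)" for x y
    by (metis minus_diff_eq minus_divide_divide)
  have neq: "{i, j, k} \<noteq> {i, k, l}" using d by auto
  have [simp]: "Min {u, v} = min u v" "Max {u, v} = max u v" for u v :: nat by auto
  consider "i < k" "j < l" | "i < k" "l < j" | "k < i" "j < l" | "k < i" "l < j"
    using d by (metis distinct_length_2_or_more linorder_neqE_nat)
  then show ?thesis
    using ne neq unfolding gamma_basis_def del add Let_def
    by cases (auto simp: insert_commute swap add.commute fun_eq_iff)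
qed

text \<open>All other triangles are mapped to themselves, so their part of the sum collapses to one
  term.\<close>

lemma gamma_flip_split:
  "\<Gamma> H H' x t' = x {i, j, k} * gamma_basis \<zeta> H H' {i, j, k} t'
     + x {i, k, l} * gamma_basis \<zeta> H H' {i, k, l} t'
     + (if t' \<in> Tri H - {{i, j, k}, {i, k, l}} then x t' else 0)"
proof -
  let ?R = "Tri H - {{i, j, k}, {i, k, l}}"
  have fin: "finite ?R" using finite_triangles[OF flip_objects(1)] by simp
  have neq: "{i, j, k} \<noteq> {i, k, l}" using flip_distinct by auto
  have "Tri H = insert {i, j, k} (insert {i, k, l} ?R)" using flip_old by auto
  then have "\<Gamma> H H' x t' = (\<Sum>t\<in>insert {i, j, k} (insert {i, k, l} ?R). x t * gamma_basis \<zeta> H H' t t')"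
    unfolding gamma_def by (rule arg_cong)
  also have "\<dots> = x {i, j, k} * gamma_basis \<zeta> H H' {i, j, k} t'
     + x {i, k, l} * gamma_basis \<zeta> H H' {i, k, l} t' + (\<Sum>t\<in>?R. x t * gamma_basis \<zeta> H H' t t')"
    using fin neq by simp
  also have "(\<Sum>t\<in>?R. x t * gamma_basis \<zeta> H H' t t') = (\<Sum>t\<in>?R. if t = t' then x t' else 0)"
    by (rule sum.cong) (auto simp: gamma_basis_flip basis_vector_def)
  also have "\<dots> = (if t' \<in> ?R then x t' else 0)"
    using fin by (simp only: sum.delta)
  finally show ?thesis .
qed

text \<open>The last two conclusions carry the triangle back to \<open>H\<close>, so that the fact
  can be applied flip after flip, backwards along a word.\<close>

lemma gamma_flip_unchanged:
  assumes "t \<in> Tri H'" "t \<notin> {{i, j, l}, {j, k, l}}"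
  shows "\<Gamma> H H' x t = x t" "t \<in> Tri H" "t \<notin> {{i, j, k}, {i, k, l}}"
proof -
  have t: "t \<in> Tri H - {{i, j, k}, {i, k, l}}" using assms flip_triangles by blast
  then show "t \<in> Tri H" "t \<notin> {{i, j, k}, {i, k, l}}" by blast+
  have "gamma_basis \<zeta> H H' {i, j, k} t = 0" "gamma_basis \<zeta> H H' {i, k, l} t = 0"
    using assms(2) by (auto simp: gamma_basis_flip basis_vector_def)
  with t show "\<Gamma> H H' x t = x t" unfolding gamma_flip_split by simp
qed

lemma gamma_flip_new:
  "\<Gamma> H H' x {i, j, l} = ((\<zeta> i - \<zeta> l) * x {i, j, k} + (\<zeta> i - \<zeta> j) * x {i, k, l}) / (\<zeta> i - \<zeta> k)"
  "\<Gamma> H H' x {j, k, l} = ((\<zeta> l - \<zeta> k) * x {i, j, k} + (\<zeta> j - \<zeta> k) * x {i, k, l}) / (\<zeta> i - \<zeta> k)"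
proof -
  have neq: "{i, j, k} \<noteq> {i, k, l}" "{i, j, l} \<noteq> {j, k, l}" using flip_distinct by auto
  have *: "gamma_basis \<zeta> H H' {i, j, k} {i, j, l} = (\<zeta> i - \<zeta> l) / (\<zeta> i - \<zeta> k)"
    "gamma_basis \<zeta> H H' {i, k, l} {i, j, l} = (\<zeta> i - \<zeta> j) / (\<zeta> i - \<zeta> k)"
    "gamma_basis \<zeta> H H' {i, j, k} {j, k, l} = (\<zeta> l - \<zeta> k) / (\<zeta> i - \<zeta> k)"
    "gamma_basis \<zeta> H H' {i, k, l} {j, k, l} = (\<zeta> j - \<zeta> k) / (\<zeta> i - \<zeta> k)"
    unfolding gamma_basis_flip basis_vector_def using neq neq[symmetric] by simp_all
  show "\<Gamma> H H' x {i, j, l} = ((\<zeta> i - \<zeta> l) * x {i, j, k} + (\<zeta> i - \<zeta> j) * x {i, k, l}) / (\<zeta> i - \<zeta> k)"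
    "\<Gamma> H H' x {j, k, l} = ((\<zeta> l - \<zeta> k) * x {i, j, k} + (\<zeta> j - \<zeta> k) * x {i, k, l}) / (\<zeta> i - \<zeta> k)"
    unfolding gamma_flip_split using flip_new_not_old by (simp_all add: * add_divide_distrib mult.commute)
qed

text \<open>The hypotheses say that \<open>w\<close> transforms by the transpose of the flip map;
  then the weighted sum is conserved, as seen after multiplying by
  \<open>\<zeta> i - \<zeta> k\<close>.\<close>

lemma gamma_flip_weight:
  fixes w :: "nat set \<Rightarrow> rat"
  assumes "(\<zeta> i - \<zeta> k) * w {i, j, k} = (\<zeta> i - \<zeta> l) * w {i, j, l} + (\<zeta> l - \<zeta> k) * w {j, k, l}"
    and "(\<zeta> i - \<zeta> k) * w {i, k, l} = (\<zeta> i - \<zeta> j) * w {i, j, l} + (\<zeta> j - \<zeta> k) * w {j, k, l}"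
  shows "\<Gamma> H H' x {i, j, l} * w {i, j, l} + \<Gamma> H H' x {j, k, l} * w {j, k, l}
       = x {i, j, k} * w {i, j, k} + x {i, k, l} * w {i, k, l}"
proof -
  define D where "D = \<zeta> i - \<zeta> k"
  have D: "D \<noteq> 0" using flip_zeta by (simp add: D_def)
  have "D * (\<Gamma> H H' x {i, j, l} * w {i, j, l} + \<Gamma> H H' x {j, k, l} * w {j, k, l})
      = ((\<zeta> i - \<zeta> l) * x {i, j, k} + (\<zeta> i - \<zeta> j) * x {i, k, l}) * w {i, j, l}
      + ((\<zeta> l - \<zeta> k) * x {i, j, k} + (\<zeta> j - \<zeta> k) * x {i, k, l}) * w {j, k, l}"
    unfolding gamma_flip_new D_def[symmetric] using D by (simp add: distrib_left)
  also have "\<dots> = x {i, j, k} * ((\<zeta> i - \<zeta> l) * w {i, j, l} + (\<zeta> l - \<zeta> k) * w {j, k, l})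
      + x {i, k, l} * ((\<zeta> i - \<zeta> j) * w {i, j, l} + (\<zeta> j - \<zeta> k) * w {j, k, l})"
    by (simp add: algebra_simps)
  also have "\<dots> = D * (x {i, j, k} * w {i, j, k} + x {i, k, l} * w {i, k, l})"
    unfolding assms[symmetric] D_def by (simp add: algebra_simps)
  finally show ?thesis using D by simp
qed

end

text \<open>The second divided difference at the nodes \<open>\<zeta> u\<close>, \<open>u \<in> t\<close>, of the function that is 1 at
  \<open>\<zeta> v\<close> and 0 at the other nodes. The flip map is the recursion of divided differences, so it
  preserves their weighted sums.\<close>

definition divided_difference :: "nat \<Rightarrow> nat set \<Rightarrow> rat" where
  "divided_difference v t = (if v \<in> t then inverse (\<Prod>u\<in>t - {v}. \<zeta> v - \<zeta> u) else 0)"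

lemma divided_difference_simps:
  assumes "distinct [u, v, w]"
  shows "divided_difference u {u, v, w} = 1 / ((\<zeta> u - \<zeta> v) * (\<zeta> u - \<zeta> w))"
    "divided_difference v {u, v, w} = 1 / ((\<zeta> v - \<zeta> u) * (\<zeta> v - \<zeta> w))"
    "divided_difference w {u, v, w} = 1 / ((\<zeta> w - \<zeta> u) * (\<zeta> w - \<zeta> v))"
proof -
  have "{u, v, w} - {u} = {v, w}" "{u, v, w} - {v} = {u, w}" "{u, v, w} - {w} = {u, v}"
    using assms by auto
  then show "divided_difference u {u, v, w} = 1 / ((\<zeta> u - \<zeta> v) * (\<zeta> u - \<zeta> w))"
    "divided_difference v {u, v, w} = 1 / ((\<zeta> v - \<zeta> u) * (\<zeta> v - \<zeta> w))"
    "divided_difference w {u, v, w} = 1 / ((\<zeta> w - \<zeta> u) * (\<zeta> w - \<zeta> v))"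
    using assms by (simp_all add: divided_difference_def inverse_eq_divide)
qed

lemma divided_difference_outside: "v \<notin> t \<Longrightarrow> divided_difference v t = 0"
  by (simp add: divided_difference_def)

text \<open>Comparing the coefficient at the node \<open>v\<close> leaves an identity of fractions:
  all three terms occur at \<open>j\<close>, two of them at each of \<open>i\<close>,
  \<open>k\<close>, \<open>l\<close>, and none elsewhere.\<close>

lemma divided_difference_flip:
  assumes d: "distinct [i, j, k, l]"
    and z: "\<zeta> i \<noteq> \<zeta> j" "\<zeta> i \<noteq> \<zeta> k" "\<zeta> i \<noteq> \<zeta> l" "\<zeta> j \<noteq> \<zeta> k" "\<zeta> j \<noteq> \<zeta> l" "\<zeta> k \<noteq> \<zeta> l"
  shows "(\<zeta> i - \<zeta> k) * divided_difference v {i, j, k}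
    = (\<zeta> i - \<zeta> l) * divided_difference v {i, j, l} + (\<zeta> l - \<zeta> k) * divided_difference v {j, k, l}"
proof -
  have e: "\<zeta> i - \<zeta> j \<noteq> 0" "\<zeta> i - \<zeta> k \<noteq> 0" "\<zeta> i - \<zeta> l \<noteq> 0" "\<zeta> j - \<zeta> k \<noteq> 0" "\<zeta> j - \<zeta> l \<noteq> 0" "\<zeta> k - \<zeta> l \<noteq> 0"
   "\<zeta> j - \<zeta> i \<noteq> 0" "\<zeta> k - \<zeta> i \<noteq> 0" "\<zeta> l - \<zeta> i \<noteq> 0" "\<zeta> k - \<zeta> j \<noteq> 0" "\<zeta> l - \<zeta> j \<noteq> 0" "\<zeta> l - \<zeta> k \<noteq> 0"
    using z by auto
  have d3: "distinct [i, j, k]" "distinct [i, j, l]" "distinct [j, k, l]" using d by auto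
  consider "v = i" | "v = j" | "v = k" | "v = l" | "v \<notin> {i, j, k, l}" by blast
  then show ?thesis
  proof cases
    case 1
    then show ?thesis using d e divided_difference_simps[OF d3(1)] divided_difference_simps[OF d3(2)]
      by (simp add: divided_difference_outside)
  next
    case 2
    show ?thesis unfolding 2 divided_difference_simps[OF d3(1)] divided_difference_simps[OF d3(2)] divided_difference_simps[OF d3(3)]
      using e by (simp add: divide_simps) (simp add: algebra_simps)
  next
    case 3
    then have "divided_difference v {i, j, l} = 0" using d by (simp add: divided_difference_outside)
    then show ?thesis
      unfolding 3 divided_difference_simps[OF d3(1)] divided_difference_simps[OF d3(3)]
      using e by (simp add: divide_simps; simp add: algebra_simps)
  next
    case 4
    then have "divided_difference v {i, j, k} = 0" using d by (simp add: divided_difference_outside)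
    then show ?thesis
      unfolding 4 divided_difference_simps[OF d3(2)] divided_difference_simps[OF d3(3)]
      using e by (simp add: divide_simps; simp add: algebra_simps)
  next
    case 5
    then show ?thesis by (simp add: divided_difference_outside)
  qed
qed

lemma gamma_flip_divided_difference:
  assumes "is_flip i j k l H H'"
  shows "\<Gamma> H H' x {i, j, l} * divided_difference v {i, j, l} + \<Gamma> H H' x {j, k, l} * divided_difference v {j, k, l}
       = x {i, j, k} * divided_difference v {i, j, k} + x {i, k, l} * divided_difference v {i, k, l}"
proof (rule gamma_flip_weight[OF assms])
  note d = flip_distinct[OF assms] and z = flip_zeta[OF assms]
  show "(\<zeta> i - \<zeta> k) * divided_difference v {i, j, k}
    = (\<zeta> i - \<zeta> l) * divided_difference v {i, j, l} + (\<zeta> l - \<zeta> k) * divided_difference v {j, k, l}"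
    using divided_difference_flip[OF d z] .
  show "(\<zeta> i - \<zeta> k) * divided_difference v {i, k, l}
    = (\<zeta> i - \<zeta> j) * divided_difference v {i, j, l} + (\<zeta> j - \<zeta> k) * divided_difference v {j, k, l}"
    using divided_difference_flip[of i l k j v] d z by (simp add: insert_commute eq_commute)
qed

text \<open>The constant weight 1 is the divided difference of the square function. It supplies the
  last equation for the pentagon.\<close>

lemma gamma_flip_sum:
  assumes "is_flip i j k l H H'"
  shows "\<Gamma> H H' x {i, j, l} + \<Gamma> H H' x {j, k, l} = x {i, j, k} + x {i, k, l}"
  using gamma_flip_weight[OF assms, of "\<lambda>_. 1" x] by simp

subsection \<open>The defining relations\<close>

text \<open>\<open>\<Gamma>\<close> ignores the values of \<open>x\<close> outside
  \<open>Tri H\<close>, so \<open>x\<close> is recovered at triangles only.\<close>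

lemma gamma_refl:
  assumes "H \<in> Objects" "t \<in> Tri H"
  shows "\<Gamma> H H x t = x t"
proof -
  have "\<Gamma> H H x t = (\<Sum>t'\<in>Tri H. if t' = t then x t else 0)"
    unfolding gamma_def by (rule sum.cong) (auto simp: gamma_basis_def basis_vector_def)
  then show ?thesis using assms finite_triangles by simp
qed

lemma gamma_relation_II:
  assumes "gen H H'" "t \<in> Tri H"
  shows "\<Gamma> H' H (\<Gamma> H H' x) t = x t"
proof (cases "H' = H")
  case True
  then show ?thesis using assms gamma_refl by (simp add: generator_def)
next
  case False
  then obtain i j k l where f: "is_flip i j k l H H'" using assms(1) by (auto simp: generator_def)
  note r = flip_reverse[OF f] and d = flip_distinct[OF f] and z = flip_zeta[OF f]
  define y where "y = \<Gamma> H' H (\<Gamma> H H' x)"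
  have w: "y {i, j, k} * divided_difference v {i, j, k} + y {i, k, l} * divided_difference v {i, k, l}
    = x {i, j, k} * divided_difference v {i, j, k} + x {i, k, l} * divided_difference v {i, k, l}" for v
    using gamma_flip_divided_difference[OF r, of "\<Gamma> H H' x" v] gamma_flip_divided_difference[OF f, of x v]
    by (simp add: y_def insert_commute add.commute)
  \<comment> \<open>Of the two triangles, node \<open>j\<close> lies only in \<open>ijk\<close> and
    node \<open>l\<close> only in \<open>ikl\<close>, so these two invariants determine the two
    coordinates.\<close>
  have "divided_difference j {i, k, l} = 0" "divided_difference l {i, j, k} = 0"
    using d by (auto intro: divided_difference_outside)
  moreover have "divided_difference j {i, j, k} \<noteq> 0" "divided_difference l {i, k, l} \<noteq> 0"
    using d z divided_difference_simps(2)[of i j k] divided_difference_simps(3)[of i k l] by auto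
  ultimately have new: "y {i, j, k} = x {i, j, k}" "y {i, k, l} = x {i, k, l}"
    using w[of j] w[of l] by simp_all
  show ?thesis
  proof (cases "t \<in> {{j, k, i}, {k, l, i}}")
    case True
    then show ?thesis using new by (auto simp: y_def insert_commute)
  next
    case False
    \<comment> \<open>Any other triangle is followed back through both flips.\<close>
    note u = gamma_flip_unchanged[OF r assms(2) False]
    have "t \<notin> {{i, j, l}, {j, k, l}}" using u(3) by (auto simp: insert_commute)
    then show ?thesis using u(1) gamma_flip_unchanged(1)[OF f u(2)] by simp
  qed
qed

lemma gamma_relation_III:
  assumes dist: "distinct [p, q, r, s, t]"
    and f1: "is_flip p q r s H1 H2" and f2: "is_flip p q s t H2 H3" and f3: "is_flip q r s t H3 H4"
    and f4: "is_flip q r t p H4 H5" and f5: "is_flip r s t p H5 H1"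
    and m: "m \<in> Tri H1"
  shows "\<Gamma> H5 H1 (\<Gamma> H4 H5 (\<Gamma> H3 H4 (\<Gamma> H2 H3 (\<Gamma> H1 H2 x)))) m = x m"
proof -
  define x2 where "x2 = \<Gamma> H1 H2 x"
  define x3 where "x3 = \<Gamma> H2 H3 x2"
  define x4 where "x4 = \<Gamma> H3 H4 x3"
  define x5 where "x5 = \<Gamma> H4 H5 x4"
  define y where "y = \<Gamma> H5 H1 x5"
  \<comment> \<open>Each flip fixes one triangle of the pentagon, which the next flip then uses;
    after the fifth flip the fixed one belongs to the fan at \<open>p\<close> again.\<close>
  have keep2: "x2 {p, s, t} = x {p, s, t}"
    unfolding x2_def by (rule gamma_flip_unchanged(1)[OF f1 flip_old(2)[OF f2] not_in_pairI[of t]])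
      (use dist in auto)
  have keep3: "x3 {q, r, s} = x2 {q, r, s}"
    unfolding x3_def by (rule gamma_flip_unchanged(1)[OF f2 flip_old(1)[OF f3] not_in_pairI[of r]])
      (use dist in auto)
  have keep4: "x4 {q, t, p} = x3 {q, t, p}"
    unfolding x4_def by (rule gamma_flip_unchanged(1)[OF f3 flip_old(2)[OF f4] not_in_pairI[of p]])
      (use dist in auto)
  have keep5: "x5 {r, s, t} = x4 {r, s, t}"
    unfolding x5_def by (rule gamma_flip_unchanged(1)[OF f4 flip_old(1)[OF f5] not_in_pairI[of s]])
      (use dist in auto)
  have keep1: "y {p, q, r} = x5 {p, q, r}"
    unfolding y_def by (rule gamma_flip_unchanged(1)[OF f5 flip_old(1)[OF f1] not_in_pairI[of q]])
      (use dist in auto)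
  note keep = keep1 keep2 keep3 keep4 keep5
  \<comment> \<open>In the sum of the five conservation laws the intermediate triangles
    cancel.\<close>
  have w: "y {p, q, r} * w {p, q, r} + y {p, r, s} * w {p, r, s} + y {p, s, t} * w {p, s, t}
    = x {p, q, r} * w {p, q, r} + x {p, r, s} * w {p, r, s} + x {p, s, t} * w {p, s, t}"
    if w: "\<And>i j k l H H' x. is_flip i j k l H H' \<Longrightarrow>
      \<Gamma> H H' x {i, j, l} * w {i, j, l} + \<Gamma> H H' x {j, k, l} * w {j, k, l}
       = x {i, j, k} * w {i, j, k} + x {i, k, l} * w {i, k, l}" for w
    using w[OF f1, of x] w[OF f2, of x2] w[OF f3, of x3] w[OF f4, of x4] w[OF f5, of x5] keep
    unfolding x2_def[symmetric] x3_def[symmetric] x4_def[symmetric] x5_def[symmetric] y_def[symmetric]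
    by (simp add: insert_commute)
  have w_dd: "y {p, q, r} * divided_difference v {p, q, r} + y {p, r, s} * divided_difference v {p, r, s}
      + y {p, s, t} * divided_difference v {p, s, t}
    = x {p, q, r} * divided_difference v {p, q, r} + x {p, r, s} * divided_difference v {p, r, s}
      + x {p, s, t} * divided_difference v {p, s, t}" for v
    by (rule w) (rule gamma_flip_divided_difference)
  \<comment> \<open>In the fan at \<open>p\<close> the nodes \<open>q\<close> and \<open>t\<close>
    lie in one triangle each. This gives the outer two coordinates, and the constant weight then
    gives the middle one.\<close>
  have "divided_difference q {p, r, s} = 0" "divided_difference q {p, s, t} = 0"
    "divided_difference t {p, q, r} = 0" "divided_difference t {p, r, s} = 0"
    using dist by (auto intro: divided_difference_outside)
  moreover have "divided_difference q {p, q, r} \<noteq> 0" "divided_difference t {p, s, t} \<noteq> 0"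
    using dist flip_zeta[OF f1] flip_zeta[OF f2]
      divided_difference_simps(2)[of p q r] divided_difference_simps(3)[of p s t] by auto
  ultimately have fan: "y {p, q, r} = x {p, q, r}" "y {p, s, t} = x {p, s, t}"
    using w_dd[of q] w_dd[of t] by simp_all
  have "y {p, q, r} + y {p, r, s} + y {p, s, t} = x {p, q, r} + x {p, r, s} + x {p, s, t}"
    using w[of "\<lambda>_. 1"] gamma_flip_sum by simp
  with fan have fan': "y {p, r, s} = x {p, r, s}" by simp
  have "y m = x m"
  proof (cases "m \<in> {{p, q, r}, {p, r, s}, {p, s, t}}")
    case True
    then show ?thesis using fan fan' by auto
  next
    case False
    \<comment> \<open>Followed backwards, a triangle off the fan is created by none of the five
      flips, so its coordinate never changes.\<close>
    then have "m \<notin> {{r, s, p}, {s, t, p}}" by (simp add: insert_commute)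
    note u5 = gamma_flip_unchanged[OF f5 m this]
    have "m \<notin> {{q, r, p}, {r, t, p}}" using False u5(3) by (simp add: insert_commute)
    note u4 = gamma_flip_unchanged[OF f4 u5(2) this]
    have "m \<notin> {{q, r, t}, {r, s, t}}" using u5(3) u4(3) by (simp add: insert_commute)
    note u3 = gamma_flip_unchanged[OF f3 u4(2) this]
    have "m \<notin> {{p, q, t}, {q, s, t}}" using u4(3) u3(3) by (simp add: insert_commute)
    note u2 = gamma_flip_unchanged[OF f2 u3(2) this]
    have "m \<notin> {{p, q, s}, {q, r, s}}" using u3(3) u2(3) by (simp add: insert_commute)
    note u1 = gamma_flip_unchanged[OF f1 u2(2) this]
    show ?thesis unfolding y_def x5_def x4_def x3_def x2_def using u1(1) u2(1) u3(1) u4(1) u5(1) by simp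
  qed
  then show ?thesis by (simp add: y_def x5_def x4_def x3_def x2_def)
qed

text \<open>The new coordinates of the primed flip depend only on its two old triangles. The other
  flip does not touch these, before or after. Exchanging the flips gives the other half of relation
  IV.\<close>

lemma gamma_commute_at_new:
  assumes card: "card ({i, j, k, l} \<inter> {i', j', k', l'}) \<le> 2"
    and f1: "is_flip i j k l H H'" and f2: "is_flip i' j' k' l' H' H''"
    and f3: "is_flip i' j' k' l' H H'''" and f4: "is_flip i j k l H''' H''"
    and t: "t \<in> {{i', j', l'}, {j', k', l'}}"
  shows "\<Gamma> H' H'' (\<Gamma> H H' x) t = \<Gamma> H''' H'' (\<Gamma> H H''' x) t"
proof -
  have d: "distinct [i, j, k, l]" "distinct [i', j', k', l']"
    using flip_distinct f1 f2 by blast+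
  \<comment> \<open>A common triangle would need three common vertices.\<close>
  have out: "m \<notin> {{i, j, l}, {j, k, l}}" if m: "m \<subseteq> {i', j', k', l'}" "card m = 3" for m
  proof
    assume "m \<in> {{i, j, l}, {j, k, l}}"
    then have "m \<subseteq> {i, j, k, l} \<inter> {i', j', k', l'}" using m(1) by auto
    then have "card m \<le> 2" using card card_mono[of "{i, j, k, l} \<inter> {i', j', k', l'}" m] by simp
    then show False using m(2) by simp
  qed
  have card3: "card {i', j', k'} = 3" "card {i', k', l'} = 3" "card {i', j', l'} = 3" "card {j', k', l'} = 3"
    using d(2) by simp_all
  have "\<Gamma> H H' x {i', j', k'} = x {i', j', k'}"
    by (rule gamma_flip_unchanged(1)[OF f1 flip_old(1)[OF f2] out]) (auto simp only: card3)
  moreover have "\<Gamma> H H' x {i', k', l'} = x {i', k', l'}"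
    by (rule gamma_flip_unchanged(1)[OF f1 flip_old(2)[OF f2] out]) (auto simp only: card3)
  ultimately have "\<Gamma> H' H'' (\<Gamma> H H' x) t = \<Gamma> H H''' x t"
    using t gamma_flip_new[OF f2, of "\<Gamma> H H' x"] gamma_flip_new[OF f3, of x] by (elim insertE) simp_all
  also have "\<dots> = \<Gamma> H''' H'' (\<Gamma> H H''' x) t"
  proof (rule gamma_flip_unchanged(1)[OF f4, symmetric])
    show "t \<in> Tri H''" using flip_new[OF f2] t by blast
    have "t \<subseteq> {i', j', k', l'}" using t by (elim insertE) simp_all
    moreover have "card t = 3" using t card3 by (elim insertE) simp_all
    ultimately show "t \<notin> {{i, j, l}, {j, k, l}}" by (rule out)
  qed
  finally show ?thesis .
qed

lemma gamma_relation_IV: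
  assumes card: "card ({i, j, k, l} \<inter> {i', j', k', l'}) \<le> 2"
    and f1: "is_flip i j k l H H'" and f2: "is_flip i' j' k' l' H' H''"
    and f3: "is_flip i' j' k' l' H H'''" and f4: "is_flip i j k l H''' H''"
    and t: "t \<in> Tri H''"
  shows "\<Gamma> H' H'' (\<Gamma> H H' x) t = \<Gamma> H''' H'' (\<Gamma> H H''' x) t"
proof -
  show ?thesis
  proof (cases "t \<in> {{i', j', l'}, {j', k', l'}}")
    case True
    then show ?thesis by (rule gamma_commute_at_new[OF card f1 f2 f3 f4])
  next
    case new': False
    show ?thesis
    proof (cases "t \<in> {{i, j, l}, {j, k, l}}")
      case True
      \<comment> \<open>The same argument with the roles of the two flips exchanged.\<close>
      have "card ({i', j', k', l'} \<inter> {i, j, k, l}) \<le> 2" using card by (simp only: Int_commute)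
      from gamma_commute_at_new[OF this f3 f4 f1 f2 True] show ?thesis by simp
    next
      case new: False
      note u2 = gamma_flip_unchanged[OF f2 t new'] and u4 = gamma_flip_unchanged[OF f4 t new]
      show ?thesis
        using u2(1) u4(1) gamma_flip_unchanged(1)[OF f1 u2(2) new] gamma_flip_unchanged(1)[OF f3 u4(2) new']
        by simp
    qed
  qed
qed

end

section \<open>Matrices of words\<close>

lemma GL_one: "1\<^sub>m d \<in> GL d"
  by (auto simp: GL_def invertible_mat_def inverts_mat_def intro!: exI[of _ "1\<^sub>m d"])

lemma GL_I:
  assumes "A \<in> carrier_mat d d" "B \<in> carrier_mat d d" "A * B = 1\<^sub>m d" "B * A = 1\<^sub>m d"
  shows "A \<in> GL d"
  using assms by (auto simp: GL_def invertible_mat_def inverts_mat_def)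

text \<open>\<open>invertible_mat\<close> leaves the format of the inverse open; the sizes of the
  two identity matrices fix it.\<close>

lemma GL_E:
  assumes "A \<in> GL d"
  obtains B where "A \<in> carrier_mat d d" "B \<in> carrier_mat d d" "A * B = 1\<^sub>m d" "B * A = 1\<^sub>m d"
proof -
  from assms obtain B where A: "A \<in> carrier_mat d d" and AB: "A * B = 1\<^sub>m d" and BA: "B * A = 1\<^sub>m (dim_row B)"
    by (auto simp: GL_def invertible_mat_def inverts_mat_def)
  have "dim_col B = d" using arg_cong[OF AB, of dim_col] by simp
  moreover have "dim_row B = d" using arg_cong[OF BA, of dim_col] A by simp
  ultimately show ?thesis using that[of B] A AB BA by auto
qed

lemma GL_mult:
  assumes "A \<in> GL d" "B \<in> GL d"
  shows "A * B \<in> GL d"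
proof -
  obtain A' where A: "A \<in> carrier_mat d d" "A' \<in> carrier_mat d d" "A * A' = 1\<^sub>m d" "A' * A = 1\<^sub>m d"
    using assms(1) by (rule GL_E)
  obtain B' where B: "B \<in> carrier_mat d d" "B' \<in> carrier_mat d d" "B * B' = 1\<^sub>m d" "B' * B = 1\<^sub>m d"
    using assms(2) by (rule GL_E)
  show ?thesis
  proof (rule GL_I[of _ _ "B' * A'"])
    have "A * B * (B' * A') = A * ((B * B') * A')"
      using A(1,2) B(1,2) by (simp add: assoc_mult_mat[of _ d d _ d _ d])
    also have "\<dots> = 1\<^sub>m d" using A B(1,2) by (simp only: B(3)) simp
    finally show "A * B * (B' * A') = 1\<^sub>m d" .
    have "B' * A' * (A * B) = B' * ((A' * A) * B)"
      using A(1,2) B(1,2) by (simp add: assoc_mult_mat[of _ d d _ d _ d])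
    also have "\<dots> = 1\<^sub>m d" using A(1,2) B by (simp only: A(4)) simp
    finally show "B' * A' * (A * B) = 1\<^sub>m d" .
  qed (use A B in auto)
qed

section \<open>Words as linear maps on triangle coordinates\<close>

context flip_groupoid
begin

text \<open>The count of faces enters here and gives all bases the same length. A finite set is
  recovered from its sorted list, so no triangle is repeated.\<close>

lemma tri_basis:
  assumes "H \<in> Objects"
  shows "set (tri_basis H) = Tri H" "distinct (tri_basis H)" "length (tri_basis H) = 2 * n + 1"
proof -
  have fin: "finite t" if "t \<in> Tri H" for t
    using triangle_labels[OF assms that] finite_subset by blast
  have set: "set (sorted_list_of_set (sorted_list_of_set ` Tri H)) = sorted_list_of_set ` Tri H"
    using finite_triangles[OF assms] by simp
  have "set ` sorted_list_of_set ` Tri H = Tri H"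
    using fin by (force simp: image_image)
  then show s: "set (tri_basis H) = Tri H"
    unfolding ordered_basis_def set_map set .
  have "inj_on sorted_list_of_set (Tri H)"
    using fin by (metis inj_onI sorted_list_of_set.set_sorted_key_list_of_set)
  then have "length (tri_basis H) = card (Tri H)"
    unfolding ordered_basis_def by (simp add: card_image)
  with s show "distinct (tri_basis H)" by (metis card_distinct)
  show "length (tri_basis H) = 2 * n + 1"
    using \<open>length (tri_basis H) = card (Tri H)\<close> card_triangles[OF assms] by simp
qed

lemma tri_basis_nth: "H \<in> Objects \<Longrightarrow> s < 2 * n + 1 \<Longrightarrow> tri_basis H ! s \<in> Tri H"
  using tri_basis[of H] nth_mem by metis

text \<open>The composite of the flip maps, first letter first; matrices of words are compared
  through it.\<close>

fun word_map :: "edges list \<Rightarrow> (nat set \<Rightarrow> rat) \<Rightarrow> nat set \<Rightarrow> rat" where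
  "word_map (H # H' # w) x = word_map (H' # w) (\<Gamma> H H' x)"
| "word_map w x = x"

lemma word_Cons2: "word (H # H' # w) \<longleftrightarrow> gen H H' \<and> word (H' # w)"
  by (auto simp: is_word_def generator_def)

lemma word_singleton: "word [H] \<longleftrightarrow> H \<in> Objects"
  by (simp add: is_word_def)

lemma word_hd: "word w \<Longrightarrow> w \<noteq> [] \<and> hd w \<in> Objects"
  by (auto simp: is_word_def)

lemma gamma_basis_vector:
  assumes "H \<in> Objects" "t \<in> Tri H"
  shows "\<Gamma> H H' (basis_vector t) = gamma_basis \<zeta> H H' t"
proof
  fix t'
  have "\<Gamma> H H' (basis_vector t) t' = (\<Sum>t''\<in>Tri H. if t'' = t then gamma_basis \<zeta> H H' t t' else 0)"
    unfolding gamma_def by (rule sum.cong) (auto simp: basis_vector_def)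
  then show "\<Gamma> H H' (basis_vector t) t' = gamma_basis \<zeta> H H' t t'"
    using assms finite_triangles by simp
qed

text \<open>Linearity in the initial coordinates. The index \<open>r\<close> is a triangle of
  \<open>last w\<close> because the one-object word returns \<open>x\<close> itself, also outside
  the triangles.\<close>

lemma word_map_expand:
  assumes "word w" "r \<in> Tri (last w)"
  shows "word_map w x r = (\<Sum>t\<in>Tri (hd w). x t * word_map w (basis_vector t) r)"
  using assms
proof (induction w arbitrary: x rule: induct_list012)
  case (3 H H' w)
  have H: "H \<in> Objects" and w: "word (H' # w)" "r \<in> Tri (last (H' # w))"
    using "3.prems" by (auto simp: word_Cons2 generator_def)
  let ?y = "\<lambda>t. word_map (H' # w) (basis_vector t) r"
  have "word_map (H # H' # w) x r = (\<Sum>t'\<in>Tri H'. \<Gamma> H H' x t' * ?y t')"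
    using "3.IH"(2)[OF w, of "\<Gamma> H H' x"] by simp
  also have "\<dots> = (\<Sum>t'\<in>Tri H'. \<Sum>t\<in>Tri H. x t * (gamma_basis \<zeta> H H' t t' * ?y t'))"
    by (simp add: gamma_def sum_distrib_right mult.assoc)
  also have "\<dots> = (\<Sum>t\<in>Tri H. x t * (\<Sum>t'\<in>Tri H'. gamma_basis \<zeta> H H' t t' * ?y t'))"
    by (subst sum.swap) (simp add: sum_distrib_left)
  also have "\<dots> = (\<Sum>t\<in>Tri H. x t * word_map (H # H' # w) (basis_vector t) r)"
  proof (rule sum.cong[OF HOL.refl])
    fix t assume "t \<in> Tri H"
    then show "x t * (\<Sum>t'\<in>Tri H'. gamma_basis \<zeta> H H' t t' * ?y t')
      = x t * word_map (H # H' # w) (basis_vector t) r"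
      using "3.IH"(2)[OF w, of "\<Gamma> H H' (basis_vector t)"] H by (simp add: gamma_basis_vector)
  qed
  finally show ?case by simp
next
  case 1
  then show ?case by (simp add: is_word_def)
next
  case (2 H)
  then have "(\<Sum>t\<in>Tri H. x t * basis_vector t r) = (\<Sum>t\<in>Tri H. if t = r then x r else 0)"
    by (intro sum.cong) (auto simp: basis_vector_def)
  then show ?case using 2 finite_triangles by (simp add: word_singleton)
qed

text \<open>Matrix product against composition: expanding the rest of the word in the basis of
  \<open>H'\<close> is the row-by-column sum.\<close>

lemma word_matrix_eq:
  assumes "word w"
  shows "W_mat w = Matrix.mat (2 * n + 1) (2 * n + 1)
    (\<lambda>(r, s). word_map w (basis_vector (tri_basis (hd w) ! s)) (tri_basis (last w) ! r))"
  using assms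
proof (induction w rule: induct_list012)
  case (3 H H' w)
  have H: "H \<in> Objects" "H' \<in> Objects" and w: "word (H' # w)"
    using "3.prems" by (auto simp: word_Cons2 generator_def)
  have last: "last (H' # w) \<in> Objects" using w by (auto simp: is_word_def)
  have reindex: "(\<Sum>t\<in>Tri H'. f t) = (\<Sum>m<2 * n + 1. f (tri_basis H' ! m))" for f :: "nat set \<Rightarrow> rat"
    using bij_betw_nth[OF tri_basis(2)[OF H(2)], of "{..<2 * n + 1}" "Tri H'"] tri_basis[OF H(2)]
    by (simp add: sum.reindex_bij_betw[symmetric])
  show ?case
  proof (rule eq_matI)
    fix r s assume "r < dim_row (Matrix.mat (2 * n + 1) (2 * n + 1)
        (\<lambda>(r, s). word_map (H # H' # w) (basis_vector (tri_basis (hd (H # H' # w)) ! s)) (tri_basis (last (H # H' # w)) ! r)))"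
      and "s < dim_col (Matrix.mat (2 * n + 1) (2 * n + 1)
        (\<lambda>(r, s). word_map (H # H' # w) (basis_vector (tri_basis (hd (H # H' # w)) ! s)) (tri_basis (last (H # H' # w)) ! r)))"
    then have rs: "r < 2 * n + 1" "s < 2 * n + 1" by simp_all
    define t where "t = tri_basis (last (H' # w)) ! r"
    define x where "x = \<Gamma> H H' (basis_vector (tri_basis H ! s))"
    have t: "t \<in> Tri (last (H' # w))" unfolding t_def using last rs by (intro tri_basis_nth)
    have "W_mat (H # H' # w) $$ (r, s)
      = (\<Sum>m<2 * n + 1. word_map (H' # w) (basis_vector (tri_basis H' ! m)) t * x (tri_basis H' ! m))"
      using rs tri_basis(3)[OF H(1)] tri_basis(3)[OF H(2)]
      by (simp add: "3.IH"(2)[OF w] flip_matrix_def scalar_prod_def t_def x_def lessThan_atLeast0)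
    also have "\<dots> = word_map (H' # w) x t"
      unfolding word_map_expand[OF w t, of x] by (simp add: reindex mult.commute)
    finally show "W_mat (H # H' # w) $$ (r, s) = Matrix.mat (2 * n + 1) (2 * n + 1)
        (\<lambda>(r, s). word_map (H # H' # w) (basis_vector (tri_basis (hd (H # H' # w)) ! s)) (tri_basis (last (H # H' # w)) ! r)) $$ (r, s)"
      using rs by (simp add: t_def x_def)
  qed (use tri_basis(3)[OF H(1)] "3.IH"(2)[OF w] in \<open>simp_all add: flip_matrix_def\<close>)
next
  case 1
  then show ?case by (simp add: is_word_def)
next
  case (2 H)
  then have H: "H \<in> Objects" by (simp add: word_singleton)
  show ?case
    by (rule eq_matI)
      (auto simp: basis_vector_def nth_eq_iff_index_eq[OF tri_basis(2)[OF H]] tri_basis(3)[OF H])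
qed

lemma word_matrix_carrier: "word w \<Longrightarrow> W_mat w \<in> carrier_mat (2 * n + 1) (2 * n + 1)"
  by (simp add: word_matrix_eq)

text \<open>Transfers the relations between flip maps, which hold at triangles, to matrices.\<close>

lemma word_matrix_cong:
  assumes "word u" "word v" "hd u = hd v" "last u = last v"
    and "\<And>x t. t \<in> Tri (last u) \<Longrightarrow> word_map u x t = word_map v x t"
  shows "W_mat u = W_mat v"
proof -
  have "last u \<in> Objects" using assms(1) by (auto simp: is_word_def)
  then show ?thesis
    unfolding word_matrix_eq[OF assms(1)] word_matrix_eq[OF assms(2)]
    by (intro eq_matI) (use assms(3-5) tri_basis_nth in auto)
qed

section \<open>Concatenation of words\<close>

lemma flip_matrix_carrier:
  "H \<in> Objects \<Longrightarrow> H' \<in> Objects \<Longrightarrow> F_mat H H' \<in> carrier_mat (2 * n + 1) (2 * n + 1)"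
  by (simp add: flip_matrix_def tri_basis(3))

lemma concat_words_hd_last:
  assumes "u \<noteq> []" "v \<noteq> []" "last u = hd v"
  shows "hd (concat_words u v) = hd u" "last (concat_words u v) = last v"
  using assms by (cases v; auto simp: concat_words_def)+

lemma word_concat:
  assumes "word u" "word v" "last u = hd v"
  shows "word (concat_words u v)"
proof -
  obtain H v' where v: "v = H # v'" using word_hd[OF assms(2)] by (cases v) auto
  then show ?thesis
    using assms by (cases v') (auto simp: is_word_def concat_words_def successively_append_iff)
qed

text \<open>The first letter acts first and so stands rightmost, which reverses the order of the
  factors.\<close>

lemma word_matrix_concat:
  assumes "word u" "word v" "last u = hd v"
  shows "W_mat (concat_words u v) = W_mat v * W_mat u"
  using assms
proof (induction u rule: induct_list012)
  case (3 H H' w)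
  have H: "H \<in> Objects" "H' \<in> Objects" and w: "word (H' # w)" "last (H' # w) = hd v"
    using "3.prems" by (auto simp: word_Cons2 generator_def)
  have "W_mat (concat_words (H # H' # w) v) = W_mat (concat_words (H' # w) v) * F_mat H H'"
    by (simp add: concat_words_def)
  also have "\<dots> = W_mat v * W_mat (H' # w) * F_mat H H'"
    using "3.IH"(2) w assms(2) by simp
  also have "\<dots> = W_mat v * W_mat (H # H' # w)"
    using assoc_mult_mat[OF word_matrix_carrier[OF assms(2)] word_matrix_carrier[OF w(1)] flip_matrix_carrier[OF H]]
    by simp
  finally show ?case .
next
  case 1
  then show ?case by (simp add: is_word_def)
next
  case (2 H)
  then have "concat_words [H] v = v" using word_hd[of v] by (simp add: concat_words_def)
  then show ?case using word_matrix_carrier[OF assms(2)] by simp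
qed

section \<open>Invariance under equivalence of words\<close>

lemma gen_sym: "gen H H' \<Longrightarrow> gen H' H"
  unfolding generator_def using flip_reverse by blast

lemma flip_gen: "is_flip i j k l H H' \<Longrightarrow> gen H H'"
  unfolding generator_def using flip_objects by blast

text \<open>Induction on the derivation. Endpoints and well-formedness are carried along because the
  rule \<open>cong\<close> needs the product formula, which holds for composable words.\<close>

lemma word_equiv_preserves:
  assumes "equiv_words u v"
  shows "word u \<and> word v \<and> hd u = hd v \<and> last u = last v \<and> W_mat u = W_mat v"
  using assms
proof (induction rule: word_equiv.induct)
  case (rel_I H)
  then have w: "word [H, H]" "word [H]" by (auto simp: is_word_def generator_def)
  moreover have "W_mat [H, H] = W_mat [H]"
    using w by (rule word_matrix_cong) (use rel_I gamma_refl in auto)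
  ultimately show ?case by simp
next
  case (rel_II H H')
  then have w: "word [H, H', H]" "word [H]" by (auto simp: word_Cons2 word_singleton generator_def)
  moreover have "W_mat [H, H', H] = W_mat [H]"
    using w by (rule word_matrix_cong) (use rel_II(1) gamma_relation_II in auto)
  ultimately show ?case by simp
next
  case (rel_III H1 H2 H3 H4 H5)
  then obtain p q r s t where d: "distinct [p, q, r, s, t]"
    and f: "is_flip p q r s H1 H2" "is_flip p q s t H2 H3" "is_flip q r s t H3 H4"
      "is_flip q r t p H4 H5" "is_flip r s t p H5 H1"
    unfolding pentagon_cycle_def by (elim exE conjE)
  have w: "word [H1, H2, H3, H4, H5, H1]" "word [H1]"
    using f[THEN flip_gen] by (auto simp: word_Cons2 word_singleton generator_def)
  moreover have "W_mat [H1, H2, H3, H4, H5, H1] = W_mat [H1]"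
    using w by (rule word_matrix_cong) (use gamma_relation_III[OF d f] in auto)
  ultimately show ?case by simp
next
  case (rel_IV H H' H'' H''')
  then obtain i j k l i' j' k' l' where c: "card ({i, j, k, l} \<inter> {i', j', k', l'}) \<le> 2"
    and f: "is_flip i j k l H H'" "is_flip i' j' k' l' H' H''"
      "is_flip i' j' k' l' H H'''" "is_flip i j k l H''' H''"
    unfolding commuting_flips_def by (elim exE conjE)
  have w: "word [H, H', H'']" "word [H, H''', H'']"
    using f[THEN flip_gen] by (auto simp: word_Cons2 word_singleton generator_def)
  moreover have "W_mat [H, H', H''] = W_mat [H, H''', H'']"
    using w by (rule word_matrix_cong) (use gamma_relation_IV[OF c f] in auto)
  ultimately show ?case by simp
next
  case (cong u v x y)
  then have u: "word u" and v: "word v" and eq: "hd u = hd v" "last u = last v" "W_mat u = W_mat v"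
    by auto
  have ne: "u \<noteq> []" "v \<noteq> []" "x \<noteq> []" "y \<noteq> []"
    using word_hd u v cong.hyps by blast+
  have uy: "word (concat_words u y)" "word (concat_words v y)"
    using word_concat u v eq cong.hyps by auto
  have hl: "hd (concat_words u y) = hd u" "last (concat_words u y) = last y"
    "hd (concat_words v y) = hd v" "last (concat_words v y) = last y"
    using concat_words_hd_last ne eq cong.hyps by auto
  have ne': "concat_words u y \<noteq> []" "concat_words v y \<noteq> []"
    using ne by (auto simp: concat_words_def)
  have "word (concat_words x (concat_words u y))" "word (concat_words x (concat_words v y))"
    using word_concat uy hl eq cong.hyps by auto
  moreover have "hd (concat_words x (concat_words u y)) = hd (concat_words x (concat_words v y))"
    "last (concat_words x (concat_words u y)) = last (concat_words x (concat_words v y))"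
    using concat_words_hd_last[OF ne(3) ne'(1)] concat_words_hd_last[OF ne(3) ne'(2)] hl eq cong.hyps by auto
  moreover have "W_mat (concat_words x (concat_words u y)) = W_mat (concat_words x (concat_words v y))"
    using word_matrix_concat u v uy hl eq cong.hyps by auto
  ultimately show ?case by blast
qed auto

text \<open>The matrix of the reverse generator is a two-sided inverse, by relation II in both
  directions.\<close>

lemma flip_matrix_GL:
  assumes "gen H H'"
  shows "F_mat H H' \<in> GL (2 * n + 1)"
proof -
  have H: "H \<in> Objects" "H' \<in> Objects" using assms by (auto simp: generator_def)
  have inv: "F_mat K' K * F_mat K K' = 1\<^sub>m (2 * n + 1)" if "gen K K'" for K K'
  proof -
    have "equiv_words [K, K', K] [K]" using that gen_sym by (intro word_equiv.rel_II)
    then have "W_mat [K, K', K] = W_mat [K]" using word_equiv_preserves by blast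
    moreover have "K \<in> Objects" "K' \<in> Objects" using that by (auto simp: generator_def)
    ultimately show ?thesis using flip_matrix_carrier[of K' K] by simp
  qed
  show ?thesis
    by (rule GL_I[OF flip_matrix_carrier[OF H] flip_matrix_carrier[OF H(2,1)]])
      (use inv assms gen_sym in blast)+
qed

lemma word_matrix_GL: "word w \<Longrightarrow> W_mat w \<in> GL (2 * n + 1)"
proof (induction w rule: induct_list012)
  case (3 H H' w)
  then have "W_mat (H' # w) * F_mat H H' \<in> GL (2 * n + 1)"
    unfolding word_Cons2 by (intro GL_mult flip_matrix_GL) blast+
  then show ?case by simp
qed (simp_all add: GL_one[of "2 * n + 1", simplified])

text \<open>The matrix is constant on the class, which contains \<open>w\<close>; so the image is a
  singleton and \<open>the_elem\<close> returns its element.\<close>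

lemma flip_rep_word_class:
  assumes "word w"
  shows "flip_rep n a b c pa pb pc \<zeta> (word_class n a b c pa pb pc w) = W_mat w"
proof -
  have w: "w \<in> word_class n a b c pa pb pc w"
    using word_equiv.refl[OF assms] by (simp add: word_class_def)
  have "W_mat v = W_mat w" if "v \<in> word_class n a b c pa pb pc w" for v
    using that word_equiv_preserves[of w v] by (simp add: word_class_def)
  then have "W_mat ` word_class n a b c pa pb pc w = (\<lambda>_. W_mat w) ` word_class n a b c pa pb pc w"
    by (rule image_cong[OF HOL.refl])
  also have "\<dots> = {W_mat w}" using w by (rule image_constant)
  finally have "W_mat ` word_class n a b c pa pb pc w = {W_mat w}" .
  then show ?thesis by (simp add: flip_rep_def)
qed

section \<open>Composition of classes\<close>

lemma word_class_eq: "equiv_words u v \<Longrightarrow> word_class n a b c pa pb pc u = word_class n a b c pa pb pc v"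
  unfolding word_class_def by (rule Collect_cong) (metis word_equiv.sym word_equiv.trans)

text \<open>\<open>cong\<close> replaces a middle factor; with an empty word first on the left and
  then on the right it replaces \<open>u\<close> and then \<open>v\<close>.\<close>

lemma concat_words_equiv:
  assumes "equiv_words u u'" "equiv_words v v'" "last u = hd v"
  shows "equiv_words (concat_words u v) (concat_words u' v')"
proof -
  have u: "word u" "word u'" "hd u = hd u'" "last u = last u'"
    and v: "word v" "word v'" "hd v = hd v'" "last v = last v'"
    using word_equiv_preserves assms(1,2) by blast+
  have unit: "concat_words w [H] = w" for w H
    by (simp add: concat_words_def)
  have ends: "word [hd u]" "word [last v]"
    using u(1) v(1) by (auto simp: is_word_def)
  have "equiv_words (concat_words [hd u] (concat_words u v)) (concat_words [hd u] (concat_words u' v))"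
    by (rule word_equiv.cong[OF assms(1) ends(1) v(1)]) (use assms(3) in auto)
  moreover have "concat_words [hd u] (concat_words w v) = concat_words w v" if "word w" "hd w = hd u" for w
    using word_hd[OF that(1)] that(2) by (cases w) (auto simp: concat_words_def)
  ultimately have 1: "equiv_words (concat_words u v) (concat_words u' v)"
    using u by simp
  have "equiv_words (concat_words u' (concat_words v [last v])) (concat_words u' (concat_words v' [last v]))"
    by (rule word_equiv.cong[OF assms(2) u(2) ends(2)]) (use assms(3) u in auto)
  then have "equiv_words (concat_words u' v) (concat_words u' v')"
    by (simp add: unit)
  with 1 show ?thesis by (rule word_equiv.trans)
qed

text \<open>All pairs of representatives give the same class, and there is at least one pair; so the
  union is a single class.\<close>

lemma compose_word_classes:
  assumes "word u" "word v" "last u = hd v"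
  shows "compose_mor n a b c pa pb pc (word_class n a b c pa pb pc u) (word_class n a b c pa pb pc v)
    = word_class n a b c pa pb pc (concat_words u v)"
proof -
  have "word_class n a b c pa pb pc (concat_words u' v') = word_class n a b c pa pb pc (concat_words u v)"
    if "u' \<in> word_class n a b c pa pb pc u" "v' \<in> word_class n a b c pa pb pc v" for u' v'
    using that assms(3) by (intro word_class_eq[symmetric] concat_words_equiv) (simp_all add: word_class_def)
  moreover have "u \<in> word_class n a b c pa pb pc u" "v \<in> word_class n a b c pa pb pc v"
    using assms(1,2) word_equiv.refl by (auto simp: word_class_def)
  ultimately show ?thesis unfolding compose_mor_def by blast
qed

end

theorem theorem2p2:
  fixes n a b c :: nat and pa pb pc :: complex and \<zeta> :: "nat \<Rightarrow> rat"
  assumes "n \<ge> 1"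
    and "{a, b, c} \<subseteq> {1..n+3}" and "distinct [a, b, c]"
    and "\<not> collinear {pa, pb, pc}"
    and "inj_on \<zeta> {1..n+3}"
  shows
    "(\<forall>H H'. generator n a b c pa pb pc H H' \<longrightarrow>
        flip_matrix n a b c pa pb pc \<zeta> H H' \<in> GL (2 * n + 1)) \<and>
     (\<forall>u v. word_equiv n a b c pa pb pc u v \<longrightarrow>
        word_matrix n a b c pa pb pc \<zeta> u = word_matrix n a b c pa pb pc \<zeta> v) \<and>
     (\<forall>w. is_word n a b c pa pb pc w \<longrightarrow>
        flip_rep n a b c pa pb pc \<zeta> (word_class n a b c pa pb pc w)
          = word_matrix n a b c pa pb pc \<zeta> w) \<and>
     (\<forall>H H'. \<forall>m \<in> Hom n a b c pa pb pc H H'.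
        flip_rep n a b c pa pb pc \<zeta> m \<in> GL (2 * n + 1)) \<and>
     (\<forall>H \<in> triangulations n a b c pa pb pc.
        flip_rep n a b c pa pb pc \<zeta> (identity_mor n a b c pa pb pc H) = 1\<^sub>m (2 * n + 1)) \<and>
     (\<forall>H H' H''. \<forall>m \<in> Hom n a b c pa pb pc H H'. \<forall>m' \<in> Hom n a b c pa pb pc H' H''.
        compose_mor n a b c pa pb pc m m' \<in> Hom n a b c pa pb pc H H'' \<and>
        flip_rep n a b c pa pb pc \<zeta> (compose_mor n a b c pa pb pc m m')
          = flip_rep n a b c pa pb pc \<zeta> m' * flip_rep n a b c pa pb pc \<zeta> m)"
proof -
  interpret flip_groupoid n a b c pa pb pc \<zeta>
    using assms(2-5) by unfold_locales
  show ?thesis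
  proof (intro conjI allI ballI impI)
    fix H H' assume "gen H H'"
    then show "F_mat H H' \<in> GL (2 * n + 1)" by (rule flip_matrix_GL)
  next
    fix u v assume "equiv_words u v"
    then show "W_mat u = W_mat v" using word_equiv_preserves by blast
  next
    fix w assume "word w"
    then show "flip_rep n a b c pa pb pc \<zeta> (word_class n a b c pa pb pc w) = W_mat w"
      by (rule flip_rep_word_class)
  next
    fix H H' m assume "m \<in> Hom n a b c pa pb pc H H'"
    then obtain w where "m = word_class n a b c pa pb pc w" "word w" by (auto simp: Hom_def)
    then show "flip_rep n a b c pa pb pc \<zeta> m \<in> GL (2 * n + 1)"
      using flip_rep_word_class word_matrix_GL by metis
  next
    fix H assume "H \<in> Objects"
    then show "flip_rep n a b c pa pb pc \<zeta> (identity_mor n a b c pa pb pc H) = 1\<^sub>m (2 * n + 1)"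
      using flip_rep_word_class[of "[H]"] by (simp add: identity_mor_def word_singleton)
  next
    fix H H' H'' m m'
    assume "m \<in> Hom n a b c pa pb pc H H'" "m' \<in> Hom n a b c pa pb pc H' H''"
    then obtain u v where m: "m = word_class n a b c pa pb pc u" "m' = word_class n a b c pa pb pc v"
      and uv: "word u" "word v" "hd u = H" "last u = hd v" "last v = H''"
      unfolding Hom_def by auto
    note comp = compose_word_classes[OF uv(1,2,4)] and w = word_concat[OF uv(1,2,4)]
    have "hd (concat_words u v) = H" "last (concat_words u v) = H''"
      using concat_words_hd_last[of u v] word_hd uv by auto
    then show "compose_mor n a b c pa pb pc m m' \<in> Hom n a b c pa pb pc H H''"
      unfolding Hom_def m comp using w by blast
    show "flip_rep n a b c pa pb pc \<zeta> (compose_mor n a b c pa pb pc m m')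
          = flip_rep n a b c pa pb pc \<zeta> m' * flip_rep n a b c pa pb pc \<zeta> m"
      unfolding m comp using uv w by (simp add: flip_rep_word_class word_matrix_concat)
  qed
qed

end
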